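(* Assume $\mathrm{cov}(\mathcal M)=\mathfrak c$ and $\mathfrak c$ is regular. Then there are ultrafilters $U,\tilde U$, a $U$-scale $X$ and a $\tilde U$-scale $Y$ such that $X\cup\mathrm{Fin}$ and $Y\cup\mathrm{Fin}$ satisfy $\mathsf S_1(\Omega_{\mathrm{Bor}},\Omega_{\mathrm{Bor}})$ but the product space $(X\cup\mathrm{Fin})\times(Y\cup\mathrm{Fin})$ is not Menger. In fact, $X$ and $Y$ themselves satisfy $\mathsf S_1(\Omega_{\mathrm{Bor}},\Omega_{\mathrm{Bor}})$ and $X\times Y$ is not Menger.
   Context: All subsets of $\mathcal P(\omega)$ carry the Cantor-space topology; $\mathrm{Fin}$ is the set of finite subsets of $\omega$ and elements of $[\omega]^\omega$ are identified with increasing enumerations. $\mathrm{cov}(\mathcal M)$ is the least number of meager sets covering $[\omega]^\omega$; $\mathfrak c=2^{\aleph_0}$. Ultrafilter: nonprincipal ultrafilter $U\subseteq[\omega]^\omega$. $a\le_U b$ iff $\{n:a(n)\le b(n)\}\in U$; $\mathfrak b(U)$ is the least size of a $\le_U$-unbounded subset of $[\omega]^\omega$; $U^+=\{a:\omega\setminus a\notin U\}$. $X\subseteq[\omega]^\omega$ is a $U$-scale if $|X|\ge\mathfrak b(U)$ and for every $d$ there are $c$ and $S\subseteq X$, $|S|<\mathfrak b(U)$, with $d\le_{U^+}c\le_U x$ for all $x\in X\setminus S$. $\mathsf S_1(\Omega_{\mathrm{Bor}},\Omega_{\mathrm{Bor}})$: for every sequence $\mathcal U_n$ of countable Borel $\omega$-covers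 (countable families of Borel sets, the space not a member, every finite set contained in a member) there are $U_n\in\mathcal U_n$ with $\{U_n\}$ an $\omega$-cover. A space is Menger if for every sequence of open covers $\mathcal U_n$ there are finite $\mathcal F_n\subseteq\mathcal U_n$ with $\bigcup_n\mathcal F_n$ a cover. *)

theory Defs
  imports "HOL-Analysis.Analysis" "HOL-Library.Infinite_Set"
begin

unbundle cardinal_syntax

section \<open>Cardinals\<close>

text \<open>The cardinal of a smallest set satisfying \<open>P\<close>; it is meaningful only if some set satisfies
  \<open>P\<close>, see \<open>least_card_attained\<close>.\<close>

definition least_card :: "('a set \<Rightarrow> bool) \<Rightarrow> 'a rel" where
  "least_card P = |SOME A. P A \<and> (\<forall>B. P B \<longrightarrow> |A| \<le>o |B| )|"

lemma least_card_attained: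
  assumes "P A"
  obtains B where "P B" "least_card P = |B|" "\<And>C. P C \<Longrightarrow> least_card P \<le>o |C|"
proof -
  let ?R = "{|B| | B. P B}"
  have "?R \<noteq> {}" "\<forall>r\<in>?R. Well_order r"
    using assms by (auto intro: card_of_Well_order)
  from exists_minim_Well_order[OF this]
  have "\<exists>B. P B \<and> (\<forall>C. P C \<longrightarrow> |B| \<le>o |C| )"
    by blast
  from someI_ex[OF this] show thesis
    by (intro that) (auto simp: least_card_def)
qed

definition continuum :: "(nat \<Rightarrow> bool) rel" where
  "continuum = ctwo ^c natLeq"


section \<open>The Cantor space of sets of natural numbers\<close>

definition cantor :: "nat set topology" where
  "cantor = pullback_topology UNIV (\<lambda>A n. n \<in> A)
     (product_topology (\<lambda>_. discrete_topology (UNIV :: bool set)) UNIV)"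

definition Fin :: "nat set set" where
  "Fin = {a. finite a}"

definition infsets :: "nat set set" where
  "infsets = {a. infinite a}"

definition nowhere_dense_in :: "'a topology \<Rightarrow> 'a set \<Rightarrow> bool" where
  "nowhere_dense_in T A \<longleftrightarrow> A \<subseteq> topspace T \<and> T interior_of (T closure_of A) = {}"

definition meager_in :: "'a topology \<Rightarrow> 'a set \<Rightarrow> bool" where
  "meager_in T A \<longleftrightarrow> (\<exists>\<N>. countable \<N> \<and> (\<forall>N\<in>\<N>. nowhere_dense_in T N) \<and> A = \<Union>\<N>)"

definition cov_meager :: "nat set set rel" where
  "cov_meager = least_card (\<lambda>\<F>. (\<forall>M\<in>\<F>. meager_in (subtopology cantor infsets) M) \<and> infsets \<subseteq> \<Union>\<F>)"


section \<open>Ultrafilters and scales\<close>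

text \<open>Nonprincipality is expressed by requiring all members to be infinite; in particular
  the empty set is not a member.\<close>

definition ultrafilter :: "nat set set \<Rightarrow> bool" where
  "ultrafilter U \<longleftrightarrow> U \<subseteq> infsets \<and> UNIV \<in> U
     \<and> (\<forall>a\<in>U. \<forall>b\<in>U. a \<inter> b \<in> U)
     \<and> (\<forall>a\<in>U. \<forall>b. a \<subseteq> b \<longrightarrow> b \<in> U)
     \<and> (\<forall>a. a \<in> U \<or> - a \<in> U)"

text \<open>An infinite set \<open>a\<close> is identified with its increasing enumeration \<open>enumerate a\<close>.\<close>

definition le_mod :: "nat set set \<Rightarrow> nat set \<Rightarrow> nat set \<Rightarrow> bool" where
  "le_mod U a b \<longleftrightarrow> {n. enumerate a n \<le> enumerate b n} \<in> U"

definition positive_sets :: "nat set set \<Rightarrow> nat set set" where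
  "positive_sets U = {a. - a \<notin> U}"

definition unbounded_mod :: "nat set set \<Rightarrow> nat set set \<Rightarrow> bool" where
  "unbounded_mod U B \<longleftrightarrow> B \<subseteq> infsets \<and> \<not> (\<exists>b\<in>infsets. \<forall>a\<in>B. le_mod U a b)"

definition bounding_number :: "nat set set \<Rightarrow> nat set rel" where
  "bounding_number U = least_card (unbounded_mod U)"

definition U_scale :: "nat set set \<Rightarrow> nat set set \<Rightarrow> bool" where
  "U_scale U X \<longleftrightarrow> X \<subseteq> infsets \<and> bounding_number U \<le>o |X| \<and>
     (\<forall>d\<in>infsets. \<exists>c\<in>infsets. \<exists>S\<subseteq>X. |S| <o bounding_number U \<and>
        (\<forall>x\<in>X - S. le_mod (positive_sets U) d c \<and> le_mod U c x))"


section \<open>Covering properties\<close>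

definition borel_sets_of :: "'a topology \<Rightarrow> 'a set set" where
  "borel_sets_of T = sigma_sets (topspace T) {V. openin T V}"

definition borel_omega_cover :: "'a topology \<Rightarrow> 'a set set \<Rightarrow> bool" where
  "borel_omega_cover T \<U> \<longleftrightarrow> countable \<U> \<and> \<U> \<subseteq> borel_sets_of T \<and> topspace T \<notin> \<U> \<and>
     (\<forall>F. finite F \<and> F \<subseteq> topspace T \<longrightarrow> (\<exists>V\<in>\<U>. F \<subseteq> V))"

definition S1_borel_omega :: "'a topology \<Rightarrow> bool" where
  "S1_borel_omega T \<longleftrightarrow>
     (\<forall>\<U> :: nat \<Rightarrow> 'a set set. (\<forall>n. borel_omega_cover T (\<U> n)) \<longrightarrow>
        (\<exists>V. (\<forall>n. V n \<in> \<U> n) \<and> borel_omega_cover T (range V)))"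

definition open_cover :: "'a topology \<Rightarrow> 'a set set \<Rightarrow> bool" where
  "open_cover T \<U> \<longleftrightarrow> (\<forall>V\<in>\<U>. openin T V) \<and> topspace T \<subseteq> \<Union>\<U>"

definition Menger_space :: "'a topology \<Rightarrow> bool" where
  "Menger_space T \<longleftrightarrow>
     (\<forall>\<U> :: nat \<Rightarrow> 'a set set. (\<forall>n. open_cover T (\<U> n)) \<longrightarrow>
        (\<exists>\<F>. (\<forall>n. finite (\<F> n) \<and> \<F> n \<subseteq> \<U> n) \<and> topspace T \<subseteq> \<Union>(\<Union>n. \<F> n)))"

end

(*
Enumerate the infinite sets as d_a, a < c, and choose by recursion x_a Cohen generic over everything
constructed before stage a, together with y_a, the complement of the symmetric difference of x_a and
d_a.  Translation by a fixed set is a homeomorphism, so y_a is generic as well.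

* Genericity makes {n. d_b(n) <= x_a(n)}, b <= a, a family with infinite finite intersections; any
  ultrafilter U containing it has b(U) = c, by regularity of c, and the x_a form a U-scale.
* The continuous map sending (x, y) to the set where x and y agree takes only infinite values on the
  products, and its range contains all d_a, so it is dominating: the products are not Menger.
* A sequence of Borel omega-covers is coded at some stage b.  Choose one member of each cover by a
  function f_b generic over x_a, a <= b.  The invariant carried through the later stages is that for
  every finite set F of points and every finite set T of cylinders some selected set contains F and is
  non-meager in each element of T.
*)

theory Submission
  imports Defs
begin

section \<open>Cylinders and category in the Cantor space\<close>

definition cyl :: "nat set \<Rightarrow> nat \<Rightarrow> nat set set" where
  "cyl p m = {x. x \<inter> {..<m} = p \<inter> {..<m}}"

lemma mem_cyl_iff: "x \<in> cyl p m \<longleftrightarrow> (\<forall>n<m. n \<in> x \<longleftrightarrow> n \<in> p)"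
  by (auto simp: cyl_def)

lemma mem_cyl_self [simp]: "p \<in> cyl p m"
  by (simp add: cyl_def)

lemma cyl_eq: "q \<in> cyl p m \<Longrightarrow> cyl q m = cyl p m"
  by (auto simp: cyl_def)

lemma cyl_antimono: "m \<le> k \<Longrightarrow> cyl p k \<subseteq> cyl p m"
  by (auto simp: mem_cyl_iff)

text \<open>Basic open sets of the product restrict finitely many coordinates, so membership is
  decided by an initial segment.\<close>

lemma openin_cantor_iff: "openin cantor S \<longleftrightarrow> (\<forall>x\<in>S. \<exists>m. cyl x m \<subseteq> S)"
proof
  assume "openin cantor S"
  then obtain W where W: "openin (product_topology (\<lambda>_. discrete_topology (UNIV :: bool set)) UNIV) W"
    and S: "S = (\<lambda>A n. n \<in> A) -` W"
    by (auto simp: cantor_def openin_pullback_topology)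
  show "\<forall>x\<in>S. \<exists>m. cyl x m \<subseteq> S"
  proof
    fix x assume "x \<in> S"
    then have "(\<lambda>n. n \<in> x) \<in> W"
      by (simp add: S)
    then obtain V where V: "finite {i::nat. V i \<noteq> (UNIV :: bool set)}" "\<forall>i. (i \<in> x) \<in> V i"
      "Pi\<^sub>E UNIV V \<subseteq> W"
      using W unfolding openin_product_topology_alt by (fastforce simp: PiE_def Pi_def)
    obtain m where m: "\<And>i. V i \<noteq> UNIV \<Longrightarrow> i < m"
      using V(1) finite_nat_set_iff_bounded by auto
    have *: "(\<lambda>n. n \<in> z) \<in> Pi\<^sub>E UNIV V" if "z \<in> cyl x m" for z
    proof -
      have "(n \<in> z) \<in> V n" for n
      proof (cases "n < m")
        case True
        then have "(n \<in> z) = (n \<in> x)"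
          using that by (simp add: mem_cyl_iff)
        then show ?thesis
          using V(2) by simp
      next
        case False
        then have "V n = UNIV"
          using m by blast
        then show ?thesis by simp
      qed
      then show ?thesis by (simp add: PiE_def Pi_def)
    qed
    have "cyl x m \<subseteq> S"
    proof
      fix z assume "z \<in> cyl x m"
      from subsetD[OF V(3) *[OF this]] show "z \<in> S"
        by (simp add: S)
    qed
    then show "\<exists>m. cyl x m \<subseteq> S" ..
  qed
next
  assume *: "\<forall>x\<in>S. \<exists>m. cyl x m \<subseteq> S"
  let ?W = "{g. {n. g n} \<in> S}"
  have "openin (product_topology (\<lambda>_. discrete_topology (UNIV :: bool set)) UNIV) ?W"
    unfolding openin_product_topology_alt
  proof (intro ballI)
    fix g assume "g \<in> ?W"
    then obtain m where m: "cyl {n. g n} m \<subseteq> S"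
      using * by auto
    define V where "V = (\<lambda>i::nat. if i < m then {g i} else UNIV)"
    have "finite {i. V i \<noteq> UNIV}"
      by (rule finite_subset[of _ "{..<m}"]) (auto simp: V_def)
    moreover have "Pi\<^sub>E UNIV V \<subseteq> ?W"
    proof
      fix h assume "h \<in> Pi\<^sub>E UNIV V"
      then have "h i = g i" if "i < m" for i
        using PiE_mem[of h UNIV V i] that by (simp add: V_def)
      then show "h \<in> ?W"
        using m by (auto simp: mem_cyl_iff)
    qed
    moreover have "g \<in> Pi\<^sub>E UNIV V"
      by (auto simp: V_def)
    ultimately show "\<exists>U. finite {i \<in> UNIV. U i \<noteq> topspace (discrete_topology (UNIV :: bool set))} \<and>
        (\<forall>i\<in>UNIV. openin (discrete_topology UNIV) (U i)) \<and> g \<in> Pi\<^sub>E UNIV U \<and> Pi\<^sub>E UNIV U \<subseteq> ?W"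
      by (intro exI[of _ V]) auto
  qed
  moreover have "S = (\<lambda>A n. n \<in> A) -` ?W"
    by simp
  ultimately show "openin cantor S"
    unfolding cantor_def openin_pullback_topology by blast
qed

lemma topspace_cantor [simp]: "topspace cantor = UNIV"
proof -
  have "openin cantor UNIV"
    by (auto simp: openin_cantor_iff)
  then show ?thesis
    using openin_subset by blast
qed

lemma openin_cyl: "openin cantor (cyl p m)"
  unfolding openin_cantor_iff by (metis cyl_eq order_refl)

text \<open>Category is handled on cylinders in the full Cantor space, where translations act;
  \<open>meager_imp_meager_in\<close> passes to the space \<open>infsets\<close> used by
  \<open>cov_meager\<close>.\<close>

definition nwd :: "nat set set \<Rightarrow> bool" where
  "nwd A \<longleftrightarrow> (\<forall>p m. \<exists>q k. m \<le> k \<and> q \<in> cyl p m \<and> cyl q k \<inter> A = {})"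

definition meager :: "nat set set \<Rightarrow> bool" where
  "meager A \<longleftrightarrow> (\<exists>N :: nat \<Rightarrow> nat set set. (\<forall>i. nwd (N i)) \<and> A \<subseteq> (\<Union>i. N i))"

lemma nwdI:
  assumes "\<And>p m. \<exists>q k. m \<le> k \<and> q \<in> cyl p m \<and> (\<forall>x\<in>cyl q k. x \<notin> A)"
  shows "nwd A"
  unfolding nwd_def using assms by (metis disjoint_iff)

lemma nwd_imp_meager: "nwd A \<Longrightarrow> meager A"
  unfolding meager_def by (rule exI[of _ "\<lambda>_. A"]) auto

lemma meager_subset: "meager B \<Longrightarrow> A \<subseteq> B \<Longrightarrow> meager A"
  unfolding meager_def by blast

lemma meager_UNION_nat:
  assumes "\<And>i::nat. meager (A i)"
  shows "meager (\<Union>i. A i)"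
proof -
  obtain N :: "nat \<Rightarrow> nat \<Rightarrow> nat set set" where N: "\<And>i j. nwd (N i j)" "\<And>i. A i \<subseteq> (\<Union>j. N i j)"
    using assms unfolding meager_def by metis
  show ?thesis
    unfolding meager_def
  proof (intro exI conjI allI)
    show "nwd (case prod_decode k of (i, j) \<Rightarrow> N i j)" for k
      by (auto simp: N split: prod.split)
    show "(\<Union>i. A i) \<subseteq> (\<Union>k. case prod_decode k of (i, j) \<Rightarrow> N i j)"
    proof
      fix x assume "x \<in> (\<Union>i. A i)"
      then obtain i j where "x \<in> N i j"
        using N(2) by blast
      then show "x \<in> (\<Union>k. case prod_decode k of (i, j) \<Rightarrow> N i j)"
        by (intro UN_I[of "prod_encode (i, j)"]) auto
    qed
  qed
qed

lemma nwd_singleton: "nwd {a}"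
proof (rule nwdI)
  fix p :: "nat set" and m :: nat
  let ?q = "if m \<in> a then p - {m} else insert m p"
  have "?q \<in> cyl p m" "\<forall>x\<in>cyl ?q (Suc m). x \<notin> {a}"
    by (auto simp: mem_cyl_iff split: if_splits)
  then show "\<exists>q k. m \<le> k \<and> q \<in> cyl p m \<and> (\<forall>x\<in>cyl q k. x \<notin> {a})"
    by (intro exI[of _ ?q] exI[of _ "Suc m"]) auto
qed

lemma meager_empty: "meager {}"
  by (rule meager_subset[OF nwd_imp_meager[OF nwd_singleton]]) simp

lemma meager_UNION_countable:
  assumes "countable I" "\<And>i. i \<in> I \<Longrightarrow> meager (A i)"
  shows "meager (\<Union>i\<in>I. A i)"
proof (cases "I = {}")
  case True
  then show ?thesis by (simp add: meager_empty)
next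
  case False
  have "meager (\<Union>n. A (from_nat_into I n))"
    by (intro meager_UNION_nat assms(2) from_nat_into False)
  then show ?thesis
    by (rule meager_subset) (use from_nat_into_surj[OF assms(1)] in blast)
qed

lemma meager_Un: "meager A \<Longrightarrow> meager B \<Longrightarrow> meager (A \<union> B)"
  using meager_UNION_countable[of "{A, B}" "\<lambda>x. x"] by auto

lemma meager_countable: "countable A \<Longrightarrow> meager A"
  using meager_UNION_countable[of A "\<lambda>a. {a}"] by (simp add: nwd_imp_meager nwd_singleton)

text \<open>Preimages commute with unions, so only nowhere dense sets need checking. Applied to the
  translations by \<open>agree\<close> and to \<open>shift_into\<close>.\<close>

lemma meager_vimage:
  assumes "\<And>A. nwd A \<Longrightarrow> nwd (h -` A)" "meager A"
  shows "meager (h -` A)"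
proof -
  obtain N :: "nat \<Rightarrow> nat set set" where N: "\<And>i. nwd (N i)" "A \<subseteq> (\<Union>i. N i)"
    using assms(2) unfolding meager_def by blast
  have "h -` A \<subseteq> (\<Union>i. h -` N i)"
    using vimage_mono[OF N(2), of h] by (simp add: vimage_UN)
  then show ?thesis
    unfolding meager_def using N(1) by (intro exI[of _ "\<lambda>i. h -` N i"] conjI allI assms(1))
qed

subsection \<open>The Baire property\<close>

definition has_bp :: "nat set set \<Rightarrow> bool" where
  "has_bp V \<longleftrightarrow> (\<exists>W. openin cantor W \<and> meager (V - W) \<and> meager (W - V))"

lemma has_bp_open: "openin cantor W \<Longrightarrow> has_bp W"
  unfolding has_bp_def by (rule exI[of _ W]) (simp add: meager_empty)

text \<open>The removed set is the interior of \<open>- W\<close>, so what remains is the boundary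
  of \<open>W\<close>: a cylinder disjoint from \<open>W\<close> lies in that interior, and any
  other one contains a smaller cylinder inside \<open>W\<close>.\<close>

lemma nwd_boundary:
  assumes "openin cantor W"
  shows "nwd (- W - {x. \<exists>m. cyl x m \<subseteq> - W})"
proof (rule nwdI)
  fix p m
  show "\<exists>q k. m \<le> k \<and> q \<in> cyl p m \<and> (\<forall>x\<in>cyl q k. x \<notin> - W - {x. \<exists>m. cyl x m \<subseteq> - W})"
  proof (cases "cyl p m \<subseteq> - W")
    case True
    then have "\<forall>x\<in>cyl p m. cyl x m \<subseteq> - W"
      by (metis cyl_eq)
    then show ?thesis
      by (intro exI[of _ p] exI[of _ m]) auto
  next
    case False
    then obtain q k where q: "q \<in> cyl p m" "cyl q k \<subseteq> W"
      using assms unfolding openin_cantor_iff by blast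
    moreover have "cyl q (max m k) \<subseteq> cyl q k"
      by (rule cyl_antimono) simp
    ultimately show ?thesis
      by (intro exI[of _ q] exI[of _ "max m k"]) auto
  qed
qed

text \<open>The interior of \<open>- W\<close> is the new open witness; it differs from
  \<open>- W\<close> by the boundary only.\<close>

lemma has_bp_Compl:
  assumes "has_bp V"
  shows "has_bp (- V)"
proof -
  obtain W where W: "openin cantor W" "meager (V - W)" "meager (W - V)"
    using assms unfolding has_bp_def by blast
  let ?Z = "{x. \<exists>m. cyl x m \<subseteq> - W}"
  have "openin cantor ?Z"
    unfolding openin_cantor_iff
  proof
    fix x assume "x \<in> ?Z"
    then obtain m where m: "cyl x m \<subseteq> - W" by blast
    have "z \<in> ?Z" if "z \<in> cyl x m" for z
      using m cyl_eq[OF that] by auto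
    then show "\<exists>m. cyl x m \<subseteq> ?Z" by blast
  qed
  moreover have "meager (- V - ?Z)"
    by (rule meager_subset[OF meager_Un[OF W(3) nwd_imp_meager[OF nwd_boundary[OF W(1)]]]]) auto
  moreover have "?Z \<subseteq> - W"
    using mem_cyl_self by blast
  then have "meager (?Z - - V)"
    by (intro meager_subset[OF W(2)]) auto
  ultimately show ?thesis
    unfolding has_bp_def by blast
qed

lemma has_bp_UNION:
  assumes "countable I" "\<And>i. i \<in> I \<Longrightarrow> has_bp (V i)"
  shows "has_bp (\<Union>i\<in>I. V i)"
proof -
  obtain W where W: "\<And>i. i \<in> I \<Longrightarrow> openin cantor (W i)" "\<And>i. i \<in> I \<Longrightarrow> meager (V i - W i)"
    "\<And>i. i \<in> I \<Longrightarrow> meager (W i - V i)"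
    using assms(2) unfolding has_bp_def by metis
  have "meager ((\<Union>i\<in>I. V i) - (\<Union>i\<in>I. W i))"
    by (rule meager_subset[OF meager_UNION_countable[OF assms(1) W(2)]]) auto
  moreover have "meager ((\<Union>i\<in>I. W i) - (\<Union>i\<in>I. V i))"
    by (rule meager_subset[OF meager_UNION_countable[OF assms(1) W(3)]]) auto
  moreover have "openin cantor (\<Union>i\<in>I. W i)"
    using W(1) by auto
  ultimately show ?thesis
    unfolding has_bp_def by blast
qed

text \<open>An open \<open>W\<close> equal to \<open>V\<close> modulo meager sets must meet every
  cylinder, so \<open>- W\<close> is nowhere dense; and \<open>- V\<close> is covered by
  \<open>- W\<close> and \<open>W - V\<close>.\<close>

lemma has_bp_comeager:
  assumes "has_bp V" "\<And>p m. \<not> meager (V \<inter> cyl p m)"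
  shows "meager (- V)"
proof -
  obtain W where W: "openin cantor W" "meager (V - W)" "meager (W - V)"
    using assms unfolding has_bp_def by blast
  have "nwd (- W)"
  proof (rule nwdI)
    fix p m
    have "\<not> V \<inter> cyl p m \<subseteq> V - W"
      using assms(2) meager_subset W(2) by blast
    then obtain q k where q: "q \<in> cyl p m" "cyl q k \<subseteq> W"
      using W(1) unfolding openin_cantor_iff by blast
    moreover have "cyl q (max m k) \<subseteq> cyl q k"
      by (rule cyl_antimono) simp
    ultimately show "\<exists>q k. m \<le> k \<and> q \<in> cyl p m \<and> (\<forall>x\<in>cyl q k. x \<notin> - W)"
      by (intro exI[of _ q] exI[of _ "max m k"]) auto
  qed
  from meager_Un[OF nwd_imp_meager[OF this] W(3)] show ?thesis
    by (rule meager_subset) auto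
qed

subsection \<open>Codes for Borel sets\<close>

text \<open>The countable index type turns quantifiers over cylinders into countable
  conjunctions.\<close>

definition basic_cyl :: "nat list \<times> nat \<Rightarrow> nat set set" where
  "basic_cyl = (\<lambda>(l, m). cyl (set l) m)"

lemma cyl_eq_basic_cyl: "\<exists>s. cyl p m = basic_cyl s"
proof -
  obtain l where l: "set l = p \<inter> {..<m}"
    using finite_list[of "p \<inter> {..<m}"] by auto
  have "cyl p m = basic_cyl (l, m)"
    by (auto simp: basic_cyl_def cyl_def l)
  then show ?thesis ..
qed

text \<open>These trees embed into \<open>nat set\<close> (\<open>inj_borel_code_to_set\<close>), so
  a single stage index can code a whole sequence of Borel covers.\<close>

datatype borel_code = Basic nat | Compl borel_code | Union "nat \<Rightarrow> borel_code"

primrec decode_borel :: "borel_code \<Rightarrow> nat set set" where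
  "decode_borel (Basic n) = basic_cyl (from_nat n)"
| "decode_borel (Compl c) = - decode_borel c"
| "decode_borel (Union c) = (\<Union>n. decode_borel (c n))"

lemma has_bp_decode_borel: "has_bp (decode_borel c)"
  by (induction c)
    (auto simp: basic_cyl_def openin_cyl has_bp_open has_bp_Compl has_bp_UNION split: prod.split)

lemma openin_cantor_imp_borel_code:
  assumes "openin cantor W"
  shows "\<exists>c. W = decode_borel c"
proof -
  \<comment> \<open>A code of the empty set, the filler at indices whose cylinder is not contained
    in \<open>W\<close>.\<close>
  let ?e = "Compl (Union Basic)"
  have U: "(\<Union>n. basic_cyl (from_nat n)) = UNIV"
  proof -
    have "x \<in> basic_cyl (from_nat (to_nat ([] :: nat list, 0 :: nat)))" for x
      by (simp add: basic_cyl_def cyl_def)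
    then show ?thesis
      by (intro equalityI subset_UNIV subsetI) (rule UN_I[OF UNIV_I])
  qed
  then have e: "decode_borel ?e = {}"
    by simp
  let ?c = "Union (\<lambda>n. if basic_cyl (from_nat n) \<subseteq> W then Basic n else ?e)"
  have "W \<subseteq> decode_borel ?c"
  proof
    fix x assume "x \<in> W"
    then obtain m where m: "cyl x m \<subseteq> W"
      using assms openin_cantor_iff by blast
    obtain s where s: "cyl x m = basic_cyl s"
      using cyl_eq_basic_cyl by blast
    have "x \<in> basic_cyl s"
      using s mem_cyl_self by blast
    with m s show "x \<in> decode_borel ?c"
      by (auto intro!: exI[of _ "to_nat s"])
  qed
  moreover have "decode_borel ?c \<subseteq> W"
    using e by (auto simp del: decode_borel.simps(2) split: if_splits)
  ultimately show ?thesis by blast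
qed

lemma borel_subtopology_imp_borel_code:
  assumes "V \<in> borel_sets_of (subtopology cantor S)"
  shows "\<exists>c. V = decode_borel c \<inter> S"
  using assms[unfolded borel_sets_of_def]
proof (induction rule: sigma_sets.induct)
  case (Basic a)
  then obtain W where "openin cantor W" "a = W \<inter> S"
    by (auto simp: openin_subtopology)
  then show ?case
    using openin_cantor_imp_borel_code by blast
next
  case Empty
  have "openin cantor {}" by simp
  then obtain c where "decode_borel c = {}"
    using openin_cantor_imp_borel_code by metis
  then show ?case by auto
next
  case (Compl a)
  then obtain c where "a = decode_borel c \<inter> S" by blast
  then have "topspace (subtopology cantor S) - a = decode_borel (borel_code.Compl c) \<inter> S"
    by auto
  then show ?case by blast
next
  case (Union a)
  then obtain c where "\<And>i. a i = decode_borel (c i) \<inter> S" by metis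
  then have "(\<Union>i. a i) = decode_borel (borel_code.Union c) \<inter> S"
    by auto
  then show ?case by blast
qed

text \<open>A code is determined by the labels of its nodes, the nodes being addressed by paths.\<close>

primrec node_label :: "borel_code \<Rightarrow> nat list \<Rightarrow> nat" where
  "node_label (Basic n) = (\<lambda>p. n + 2)"
| "node_label (Compl c) = (\<lambda>p. case p of [] \<Rightarrow> 0 | _ # q \<Rightarrow> node_label c q)"
| "node_label (Union c) = (\<lambda>p. case p of [] \<Rightarrow> 1 | i # q \<Rightarrow> node_label (c i) q)"

text \<open>The root label identifies the constructor: 0 for \<open>Compl\<close>, 1 for
  \<open>Union\<close>, at least 2 for \<open>Basic\<close>. Longer paths give back the labels of
  the subtrees.\<close>

lemma node_label_inject: "node_label c = node_label d \<Longrightarrow> c = d"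
proof (induction c arbitrary: d)
  case (Basic n)
  from fun_cong[OF this, of "[]"] show ?case
    by (cases d) auto
next
  case (Compl c)
  from fun_cong[OF Compl.prems, of "[]"] obtain d' where d: "d = Compl d'"
    by (cases d) auto
  have "node_label c q = node_label d' q" for q
    using fun_cong[OF Compl.prems, of "0 # q"] by (simp add: d)
  then show ?case
    using Compl.IH d by blast
next
  case (Union c)
  from fun_cong[OF Union.prems, of "[]"] obtain d' where d: "d = Union d'"
    by (cases d) auto
  have "node_label (c i) q = node_label (d' i) q" for i q
    using fun_cong[OF Union.prems, of "i # q"] by (simp add: d)
  then have "c i = d' i" for i
    using Union.IH by blast
  then show ?case
    by (auto simp: d)
qed

definition borel_code_to_set :: "borel_code \<Rightarrow> nat set" where
  "borel_code_to_set c = {to_nat (p, node_label c p) | p. True}"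

lemma inj_borel_code_to_set: "inj borel_code_to_set"
proof (rule injI)
  fix c d assume *: "borel_code_to_set c = borel_code_to_set d"
  have "node_label c p = node_label d p" for p
  proof -
    have "to_nat (p, node_label c p) \<in> borel_code_to_set d"
      unfolding *[symmetric] by (auto simp: borel_code_to_set_def)
    then show ?thesis
      by (auto simp: borel_code_to_set_def)
  qed
  then show "c = d"
    using node_label_inject by blast
qed

text \<open>Every set of naturals is read as a double sequence of Borel sets, \<open>n\<close>
  numbering the covers and \<open>i\<close> the members of a cover; \<open>{}\<close> is a default
  value.\<close>

definition decode_family :: "nat set \<Rightarrow> nat \<Rightarrow> nat \<Rightarrow> nat set set" where
  "decode_family a n i = (case inv borel_code_to_set a of
     Union c \<Rightarrow> decode_borel (c (prod_encode (n, i))) | _ \<Rightarrow> {})"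

lemma has_bp_decode_family: "has_bp (decode_family a n i)"
  by (auto simp: decode_family_def has_bp_decode_borel has_bp_open split: borel_code.split)

lemma decode_family_surj: "\<exists>a. \<forall>n i. decode_family a n i = decode_borel (c n i)"
proof -
  let ?c = "Union (\<lambda>k. case prod_decode k of (n, i) \<Rightarrow> c n i)"
  have "decode_family (borel_code_to_set ?c) n i = decode_borel (c n i)" for n i
    by (simp add: decode_family_def inv_f_f[OF inj_borel_code_to_set])
  then show ?thesis by blast
qed

section \<open>Generic reals\<close>

definition small :: "'a set \<Rightarrow> bool" where
  "small A \<longleftrightarrow> |A| <o |UNIV :: nat set set|"

lemma small_subset: "small B \<Longrightarrow> A \<subseteq> B \<Longrightarrow> small A"
  unfolding small_def by (meson card_of_mono1 ordLeq_ordLess_trans)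

lemma small_image: "small A \<Longrightarrow> small (f ` A)"
  unfolding small_def by (meson card_of_image ordLeq_ordLess_trans)

lemma small_countable:
  assumes "countable A"
  shows "small A"
proof -
  obtain f :: "_ \<Rightarrow> nat" where "inj_on f A"
    using assms countable_def by blast
  then have "|A| \<le>o |UNIV :: nat set|"
    using card_of_ordLeq by blast
  moreover have "|UNIV :: nat set| <o |UNIV :: nat set set|"
    using card_of_Pow[of "UNIV :: nat set"] by simp
  ultimately show ?thesis
    unfolding small_def by (rule ordLeq_ordLess_trans)
qed

lemma small_underS: "small (underS |UNIV :: nat set set| a)"
  unfolding small_def using card_of_underS[OF card_of_Card_order] by (metis Field_card_of UNIV_I)

lemma continuum_eq: "continuum = |UNIV :: (nat \<Rightarrow> bool) set|"
  by (simp add: continuum_def cexp_def Func_def Field_natLeq ctwo_def Field_card_of)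

lemma continuum_ordIso: "continuum =o |UNIV :: nat set set|"
proof -
  have "bij_betw Collect (UNIV :: (nat \<Rightarrow> bool) set) UNIV"
    by (rule bij_betw_byWitness[of _ "\<lambda>A n. n \<in> A"]) auto
  then show ?thesis
    unfolding continuum_eq by (rule card_of_ordIsoI)
qed

section \<open>Translations and shifts of the Cantor space\<close>

definition agree :: "nat set \<Rightarrow> nat set \<Rightarrow> nat set" where
  "agree x y = {n. n \<in> x \<longleftrightarrow> n \<in> y}"

lemma agree_agree [simp]: "agree x (agree x d) = d" "agree (agree x d) d = x"
  by (auto simp: agree_def)

lemma agree_commute: "agree x y = agree y x"
  by (auto simp: agree_def)

lemma agree_UNIV [simp]: "agree x UNIV = x"
  by (auto simp: agree_def)

lemma agree_empty [simp]: "agree x {} = - x"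
  by (auto simp: agree_def)

lemma agree_mem_cyl_iff: "agree x d \<in> cyl (agree p d) m \<longleftrightarrow> x \<in> cyl p m"
  by (auto simp: agree_def mem_cyl_iff)

lemma nwd_vimage_agree:
  assumes "nwd A"
  shows "nwd ((\<lambda>x. agree x d) -` A)"
proof (rule nwdI)
  fix p m
  obtain q k where q: "m \<le> k" "q \<in> cyl (agree p d) m" "cyl q k \<inter> A = {}"
    using assms unfolding nwd_def by blast
  have "agree q d \<in> cyl p m"
    using q(2) agree_mem_cyl_iff[of q d "agree p d" m] by simp
  moreover have "agree x d \<in> cyl q k" if "x \<in> cyl (agree q d) k" for x
    using agree_mem_cyl_iff[of x d "agree q d" k] that by simp
  ultimately show "\<exists>q k. m \<le> k \<and> q \<in> cyl p m \<and> (\<forall>x\<in>cyl q k. x \<notin> (\<lambda>x. agree x d) -` A)"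
    using q(1,3) by (intro exI[of _ "agree q d"] exI[of _ k]) auto
qed

text \<open>A homeomorphism of the whole Cantor space onto \<open>cyl p m\<close>; it turns a
  covering of one cylinder into a covering of the whole space.\<close>

definition shift_into :: "nat set \<Rightarrow> nat \<Rightarrow> nat set \<Rightarrow> nat set" where
  "shift_into p m x = (p \<inter> {..<m}) \<union> (+) m ` x"

lemma mem_shift_into_iff: "n \<in> shift_into p m x \<longleftrightarrow> (if n < m then n \<in> p else n - m \<in> x)"
  by (auto simp: shift_into_def intro: image_eqI[of _ _ "n - m"])

lemma shift_into_mem_cyl: "shift_into p m x \<in> cyl p m"
  by (simp add: mem_cyl_iff mem_shift_into_iff)

lemma nwd_vimage_shift_into:
  assumes "nwd A"
  shows "nwd (shift_into p m -` A)"
proof (rule nwdI)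
  fix p' m'
  \<comment> \<open>Depth \<open>m + m'\<close> keeps the first \<open>m\<close> bits those of
    \<open>p\<close>; deleting them leaves a condition that extends \<open>p'\<close> up to
    \<open>m'\<close>.\<close>
  obtain q k where q: "m + m' \<le> k" "q \<in> cyl (shift_into p m p') (m + m')" "cyl q k \<inter> A = {}"
    using assms unfolding nwd_def by blast
  let ?q = "{n. m + n \<in> q}"
  have "?q \<in> cyl p' m'"
    using q(2) by (auto simp: mem_cyl_iff mem_shift_into_iff)
  moreover have "shift_into p m x \<in> cyl q k" if "x \<in> cyl ?q (k - m)" for x
    unfolding mem_cyl_iff
  proof (intro allI impI)
    fix n assume n: "n < k"
    show "n \<in> shift_into p m x \<longleftrightarrow> n \<in> q"
    proof (cases "n < m")
      case True
      then show ?thesis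
        using q(2) by (auto simp: mem_cyl_iff mem_shift_into_iff)
    next
      case False
      then have "n - m \<in> x \<longleftrightarrow> m + (n - m) \<in> q"
        using that n by (simp add: mem_cyl_iff)
      with False show ?thesis
        by (simp add: mem_shift_into_iff)
    qed
  qed
  ultimately show "\<exists>q k. m' \<le> k \<and> q \<in> cyl p' m' \<and> (\<forall>x\<in>cyl q k. x \<notin> shift_into p m -` A)"
    using q(1,3) by (intro exI[of _ ?q] exI[of _ "k - m"]) auto
qed

section \<open>Category relative to the infinite sets\<close>

lemma nwd_imp_nowhere_dense_in:
  assumes "nwd N" "A \<subseteq> N \<inter> infsets"
  shows "nowhere_dense_in (subtopology cantor infsets) A"
proof -
  let ?T = "subtopology cantor infsets"
  have "x \<notin> ?T interior_of (?T closure_of A)" for x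
  proof
    assume "x \<in> ?T interior_of (?T closure_of A)"
    then obtain W where W: "openin cantor W" "x \<in> W" "W \<inter> infsets \<subseteq> ?T closure_of A"
      by (auto simp: interior_of_def openin_subtopology)
    then obtain m where m: "cyl x m \<subseteq> W"
      using openin_cantor_iff by blast
    obtain q k where q: "m \<le> k" "q \<in> cyl x m" "cyl q k \<inter> N = {}"
      using assms(1) unfolding nwd_def by blast
    \<comment> \<open>A cofinite member of \<open>cyl q k\<close>: the infinite sets are dense, so
      the cylinder is not empty in the subspace.\<close>
    let ?z = "(q \<inter> {..<k}) \<union> {k..}"
    have z: "?z \<in> cyl q k" "?z \<in> infsets"
      using infinite_Ici[of k] by (auto simp: mem_cyl_iff infsets_def)
    have "cyl q k \<subseteq> cyl x m"
      using q by (metis cyl_antimono cyl_eq)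
    then have "?z \<in> ?T closure_of A"
      using z m W(3) by blast
    moreover have "openin ?T (cyl q k \<inter> infsets)"
      using openin_cyl openin_subtopology by blast
    ultimately obtain y where "y \<in> A" "y \<in> cyl q k"
      using z unfolding in_closure_of by blast
    then show False
      using assms(2) q(3) by blast
  qed
  then show ?thesis
    using assms(2) by (auto simp: nowhere_dense_in_def)
qed

lemma meager_imp_meager_in:
  assumes "meager M"
  shows "meager_in (subtopology cantor infsets) (M \<inter> infsets)"
proof -
  obtain N :: "nat \<Rightarrow> nat set set" where N: "\<And>i. nwd (N i)" "M \<subseteq> (\<Union>i. N i)"
    using assms unfolding meager_def by blast
  let ?N = "range (\<lambda>i. N i \<inter> (M \<inter> infsets))"
  have "\<forall>A\<in>?N. nowhere_dense_in (subtopology cantor infsets) A"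
    using nwd_imp_nowhere_dense_in[OF N(1)] by blast
  moreover have "M \<inter> infsets = \<Union>?N"
    using N(2) by blast
  ultimately show ?thesis
    unfolding meager_in_def by (intro exI[of _ ?N]) simp
qed

text \<open>If the entry of index \<open>n\<close> were below \<open>k\<close>, so would be all
  \<open>n + 1\<close> entries of index at most \<open>n\<close>.\<close>

lemma enumerate_ge_if_card_le:
  fixes c :: "nat set"
  assumes "infinite c" "card (c \<inter> {..<k}) \<le> n"
  shows "k \<le> enumerate c n"
proof (rule ccontr)
  assume "\<not> k \<le> enumerate c n"
  then have "enumerate c i < k" if "i \<le> n" for i
    using iffD2[OF enumerate_mono_le_iff[OF assms(1)] that] by linarith
  then have "enumerate c ` {..n} \<subseteq> c \<inter> {..<k}"
    using enumerate_in_set[OF assms(1)] by auto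
  then have "card (enumerate c ` {..n}) \<le> card (c \<inter> {..<k})"
    by (intro card_mono) auto
  moreover have "card (enumerate c ` {..n}) = Suc n"
    using card_image[of "enumerate c" "{..n}"] strict_mono_enumerate[OF assms(1)]
    by (simp add: strict_mono_imp_inj_on inj_on_subset)
  ultimately show False
    using assms(2) by simp
qed

text \<open>The working form of Cohen genericity: the exceptions lie in fewer than continuum many
  meager sets. By \<open>generically_exists\<close> such properties have witnesses in every
  cylinder.\<close>

definition generically :: "(nat set \<Rightarrow> bool) \<Rightarrow> bool" where
  "generically P \<longleftrightarrow> (\<exists>\<M>. small \<M> \<and> (\<forall>M\<in>\<M>. meager M) \<and> {x. \<not> P x} \<subseteq> \<Union>\<M>)"

text \<open>Reads a set of naturals as a function, so that a generic set yields a generic choice of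
  one member from each cover.\<close>

definition selector :: "nat set \<Rightarrow> nat \<Rightarrow> nat" where
  "selector x n = (LEAST i. prod_encode (n, i) \<in> x)"

section \<open>Calculus of generic properties under the cardinal hypotheses\<close>

locale cov_meager_continuum =
  assumes cov: "cov_meager =o continuum"
    and reg: "regularCard continuum"
begin

lemma Cinfinite_card_sets: "Cinfinite |UNIV :: nat set set|"
  using card_of_Card_order[of "UNIV :: nat set set"]
  by (simp add: cinfinite_def Field_card_of Finite_Set.finite_set)

lemma regularCard_sets: "regularCard |UNIV :: nat set set|"
  using regularCard_ordIso[OF continuum_ordIso _ reg] Cinfinite_cong[OF ordIso_symmetric[OF continuum_ordIso]]
    Cinfinite_card_sets by blast

lemma small_UNION:
  assumes "small I" "\<And>i. i \<in> I \<Longrightarrow> small (A i)"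
  shows "small (\<Union>i\<in>I. A i)"
  using regularCard_UNION_bound[OF Cinfinite_card_sets regularCard_sets] assms
  unfolding small_def by blast

text \<open>By regularity a small set is not cofinal: some index has no member of \<open>K\<close>
  strictly above it, and linearity makes it an upper bound.\<close>

lemma small_bounded:
  assumes "small K"
  shows "\<exists>a. \<forall>b\<in>K. (b, a) \<in> |UNIV :: nat set set|"
proof -
  let ?r = "|UNIV :: nat set set|"
  have "\<not> |K| =o ?r"
    using assms not_ordLess_ordIso unfolding small_def by blast
  then have "\<not> cofinal K ?r"
    using regularCard_sets unfolding regularCard_def by (auto simp: Field_card_of)
  then obtain a where a: "\<And>b. b \<in> K \<Longrightarrow> a = b \<or> (a, b) \<notin> ?r"
    unfolding cofinal_def by (auto simp: Field_card_of)
  have "(b, a) \<in> ?r" if "b \<in> K" for b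
    using a[OF that] card_of_Well_order[of "UNIV :: nat set set"]
    unfolding well_order_on_def linear_order_on_def total_on_def partial_order_on_def preorder_on_def refl_on_def
    by (metis Field_card_of UNIV_I)
  then show ?thesis by blast
qed

lemma small_insert: "small A \<Longrightarrow> small (insert a A)"
  using small_UNION[of "{A, {a}}" "\<lambda>x. x"] small_countable[of "{a}"] small_countable[of "{A, {a}}"] by auto

lemma small_Times:
  assumes "small A" "small B"
  shows "small (A \<times> B)"
proof -
  have "A \<times> B = (\<Union>a\<in>A. Pair a ` B)"
    by auto
  then show ?thesis
    using small_UNION[OF assms(1)] small_image[OF assms(2)] by metis
qed

lemma small_Fpow:
  assumes "small A"
  shows "small (Fpow A)"
proof -
  have "small {l. set l \<subseteq> A \<and> length l = n}" for n
  proof (induction n)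
    case 0
    then show ?case
      by (intro small_subset[OF small_countable[of "{[]}"]]) auto
  next
    case (Suc n)
    have "small (\<Union>a\<in>A. (#) a ` {l. set l \<subseteq> A \<and> length l = n})"
      by (intro small_UNION assms small_image Suc)
    then show ?case
      by (rule small_subset) (auto simp: length_Suc_conv)
  qed
  then have "small (\<Union>n. {l. set l \<subseteq> A \<and> length l = n})"
    by (intro small_UNION[OF small_countable]) simp_all
  then have "small (set ` (\<Union>n. {l. set l \<subseteq> A \<and> length l = n}))"
    by (rule small_image)
  then show ?thesis
    by (rule small_subset) (auto simp: Fpow_def image_iff dest!: finite_list)
qed

lemma generically_comeager: "meager {x. \<not> P x} \<Longrightarrow> generically P"
  unfolding generically_def by (intro exI[of _ "{{x. \<not> P x}}"]) (auto simp: small_countable)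

lemma generically_True: "generically (\<lambda>_. True)"
  by (rule generically_comeager) (simp add: meager_empty)

text \<open>Regularity of the continuum enters here: a small union of small families of meager sets
  is a small family.\<close>

lemma generically_ball:
  assumes "small I" "\<And>i. i \<in> I \<Longrightarrow> generically (P i)"
  shows "generically (\<lambda>x. \<forall>i\<in>I. P i x)"
proof -
  obtain \<M> where M: "\<And>i. i \<in> I \<Longrightarrow> small (\<M> i)" "\<And>i M. i \<in> I \<Longrightarrow> M \<in> \<M> i \<Longrightarrow> meager M"
    "\<And>i. i \<in> I \<Longrightarrow> {x. \<not> P i x} \<subseteq> \<Union>(\<M> i)"
    using assms(2) unfolding generically_def by metis
  show ?thesis
    unfolding generically_def
  proof (intro exI conjI)
    show "small (\<Union>i\<in>I. \<M> i)"
      by (intro small_UNION assms(1) M(1))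
    show "{x. \<not> (\<forall>i\<in>I. P i x)} \<subseteq> \<Union>(\<Union>i\<in>I. \<M> i)"
    proof
      fix x assume "x \<in> {x. \<not> (\<forall>i\<in>I. P i x)}"
      then obtain i where "i \<in> I" "x \<in> {x. \<not> P i x}"
        by auto
      then show "x \<in> \<Union>(\<Union>i\<in>I. \<M> i)"
        using subsetD[OF M(3)] by blast
    qed
  qed (use M(2) in auto)
qed

lemma generically_all:
  fixes P :: "'i::countable \<Rightarrow> nat set \<Rightarrow> bool"
  assumes "\<And>i. generically (P i)"
  shows "generically (\<lambda>x. \<forall>i. P i x)"
  using generically_ball[of UNIV P] assms by (simp add: small_countable)

lemma generically_conj:
  assumes "generically P" "generically Q"
  shows "generically (\<lambda>x. P x \<and> Q x)"
  using generically_all[of "\<lambda>b. if b then P else Q"] assms by (simp add: all_bool_eq)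

lemma generically_imp: "(Q \<Longrightarrow> generically P) \<Longrightarrow> generically (\<lambda>x. Q \<longrightarrow> P x)"
  by (cases Q) (simp_all add: generically_True)

lemma generically_mono:
  assumes "generically P" "\<And>x. P x \<Longrightarrow> Q x"
  shows "generically Q"
proof -
  obtain \<M> where M: "small \<M>" "\<forall>M\<in>\<M>. meager M" "{x. \<not> P x} \<subseteq> \<Union>\<M>"
    using assms(1) unfolding generically_def by blast
  have "{x. \<not> Q x} \<subseteq> {x. \<not> P x}"
    using assms(2) by blast
  then have "{x. \<not> Q x} \<subseteq> \<Union>\<M>"
    using M(3) by (rule subset_trans)
  with M(1,2) show ?thesis
    unfolding generically_def by blast
qed

lemma generically_agree:
  assumes "generically P"
  shows "generically (\<lambda>x. P (agree x d))"
proof -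
  let ?h = "\<lambda>x. agree x d"
  obtain \<M> where M: "small \<M>" "\<forall>M\<in>\<M>. meager M" "{x. \<not> P x} \<subseteq> \<Union>\<M>"
    using assms unfolding generically_def by blast
  have "small ((-`) ?h ` \<M>)"
    by (intro small_image M(1))
  moreover have "\<forall>M\<in>(-`) ?h ` \<M>. meager M"
    using M(2) meager_vimage[OF nwd_vimage_agree] by blast
  moreover have "{x. \<not> P (?h x)} \<subseteq> \<Union>((-`) ?h ` \<M>)"
    using M(3) by blast
  ultimately show ?thesis
    unfolding generically_def by blast
qed

text \<open>If the cylinder consisted of exceptions, pulling the meager sets back along
  \<open>shift_into p m\<close> would cover \<open>infsets\<close> by fewer than
  \<open>cov_meager\<close> meager sets.\<close>

lemma generically_exists:
  assumes "generically P"
  shows "\<exists>x\<in>cyl p m. P x"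
proof (rule ccontr)
  assume *: "\<not> (\<exists>x\<in>cyl p m. P x)"
  obtain \<M> where M: "small \<M>" "\<forall>M\<in>\<M>. meager M" "{x. \<not> P x} \<subseteq> \<Union>\<M>"
    using assms unfolding generically_def by blast
  let ?F = "(\<lambda>M. shift_into p m -` M \<inter> infsets) ` \<M>"
  let ?P = "\<lambda>\<F>. (\<forall>M\<in>\<F>. meager_in (subtopology cantor infsets) M) \<and> infsets \<subseteq> \<Union>\<F>"
  have "meager_in (subtopology cantor infsets) A" if "A \<in> ?F" for A
    using that M(2) meager_imp_meager_in[OF meager_vimage[OF nwd_vimage_shift_into]] by blast
  moreover have "infsets \<subseteq> \<Union>?F"
  proof
    fix x :: "nat set" assume "x \<in> infsets"
    moreover obtain M where "M \<in> \<M>" "shift_into p m x \<in> M"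
      using * shift_into_mem_cyl[of p m x] subsetD[OF M(3), of "shift_into p m x"] by auto
    ultimately show "x \<in> \<Union>?F" by auto
  qed
  ultimately have F: "?P ?F" by blast
  have "cov_meager \<le>o |?F|"
    unfolding cov_meager_def
  proof (rule least_card_attained[of ?P, OF F])
    assume "\<And>C. ?P C \<Longrightarrow> least_card ?P \<le>o |C|"
    from this[OF F] show "least_card ?P \<le>o |?F|" .
  qed
  moreover have "|?F| <o |UNIV :: nat set set|"
    using small_image[OF M(1)] unfolding small_def .
  moreover have "|UNIV :: nat set set| =o cov_meager"
    using ordIso_transitive[OF cov continuum_ordIso] ordIso_symmetric by blast
  ultimately have "cov_meager <o cov_meager"
    using ordLeq_ordLess_trans ordLess_ordIso_trans by blast
  then show False
    using ordLess_irreflexive by blast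
qed

section \<open>Density arguments for a single generic set\<close>

lemma generically_infinite_agree: "generically (\<lambda>x. infinite (agree x w))"
proof (rule generically_comeager, rule meager_countable)
  have "countable {F :: nat set. finite F}"
    using countable_Collect_finite by simp
  then have "countable ((\<lambda>F. agree F w) ` {F. finite F})"
    by (rule countable_image)
  moreover have "{x. \<not> infinite (agree x w)} \<subseteq> (\<lambda>F. agree F w) ` {F. finite F}"
  proof
    fix x assume "x \<in> {x. \<not> infinite (agree x w)}"
    then show "x \<in> (\<lambda>F. agree F w) ` {F. finite F}"
      by (intro image_eqI[of _ _ "agree x w"]) auto
  qed
  ultimately show "countable {x. \<not> infinite (agree x w)}"
    by (rule countable_subset[rotated])
qed

lemma generically_enumerate_ge:
  assumes "infinite C"
  shows "generically (\<lambda>x. infinite {n \<in> C. g n \<le> enumerate x n})"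
proof -
  \<comment> \<open>\<open>infinite x\<close> is a premise because \<open>enumerate\<close> is
    controlled only on infinite sets; genericity discharges it below.\<close>
  have "generically (\<lambda>x. infinite x \<longrightarrow> (\<exists>n\<in>C. N \<le> n \<and> g n \<le> enumerate x n))" for N
  proof (rule generically_comeager, rule nwd_imp_meager, rule nwdI)
    fix p m
    obtain n where n: "n \<in> C" "max N m \<le> n"
      using assms infinite_nat_iff_unbounded_le by blast
    \<comment> \<open>The condition is prolonged by a gap up to \<open>?k\<close>. At most
      \<open>m\<close> elements lie below \<open>?k\<close>, and \<open>n\<close> is at least
      \<open>m\<close>, so the entry of index \<open>n\<close> lies beyond the gap.\<close>
    let ?q = "p \<inter> {..<m}" and ?k = "max m (g n)"
    have "g n \<le> enumerate x n" if "infinite x" "x \<in> cyl ?q ?k" for x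
    proof -
      have "x \<inter> {..<?k} \<subseteq> {..<m}"
        using that(2) by (auto simp: mem_cyl_iff)
      then have "card (x \<inter> {..<?k}) \<le> n"
        using card_mono[of "{..<m}" "x \<inter> {..<?k}"] n(2) by simp
      from enumerate_ge_if_card_le[OF that(1) this] show ?thesis by simp
    qed
    moreover have "?q \<in> cyl p m"
      by (simp add: mem_cyl_iff)
    ultimately show "\<exists>q k. m \<le> k \<and> q \<in> cyl p m \<and>
        (\<forall>x\<in>cyl q k. x \<notin> {x. \<not> (infinite x \<longrightarrow> (\<exists>n\<in>C. N \<le> n \<and> g n \<le> enumerate x n))})"
      using n by (intro exI[of _ ?q] exI[of _ ?k]) auto
  qed
  then have "generically (\<lambda>x. (\<forall>N. infinite x \<longrightarrow> (\<exists>n\<in>C. N \<le> n \<and> g n \<le> enumerate x n)) \<and> infinite x)"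
    using generically_infinite_agree[of UNIV] by (intro generically_conj generically_all) simp_all
  then show ?thesis
    by (rule generically_mono) (auto simp: infinite_nat_iff_unbounded_le)
qed

lemma generically_selector:
  assumes "\<And>n. \<exists>i. Q n i"
  shows "generically (\<lambda>x. \<exists>n. Q n (selector x n))"
proof (rule generically_comeager, rule nwd_imp_meager, rule nwdI)
  fix p m
  \<comment> \<open>The condition decides only numbers below \<open>m\<close>, while every code of a
    pair in row \<open>m\<close> is at least \<open>m\<close>; so row \<open>m\<close> is still
    free.\<close>
  obtain i where i: "Q m i"
    using assms by blast
  let ?e = "\<lambda>j. prod_encode (m, j)"
  \<comment> \<open>Codes grow with the second component. Deciding everything up to
    \<open>?e i\<close> therefore excludes all smaller candidates and makes \<open>i\<close> the
    least one.\<close>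
  let ?q = "(p \<inter> {..<m}) \<union> {?e i}" and ?k = "Suc (?e i)"
  have ge: "m \<le> ?e j" for j
    by (rule le_prod_encode_1)
  have mono: "?e j < ?e i" if "j < i" for j
  proof -
    have "triangle a < triangle b" if "a < b" for a b
      using that by (induction b) (auto simp: less_Suc_eq)
    then show ?thesis
      using that by (simp add: prod_encode_def)
  qed
  have "selector x m = i" if "x \<in> cyl ?q ?k" for x
    unfolding selector_def
  proof (rule Least_equality)
    show "?e i \<in> x"
      using that by (simp add: mem_cyl_iff)
  next
    fix j assume j: "?e j \<in> x"
    show "i \<le> j"
    proof (rule ccontr)
      assume "\<not> i \<le> j"
      then have "?e j < ?e i"
        using mono by simp
      then have "?e j \<in> ?q"
        using that j by (auto simp: mem_cyl_iff)
      then show False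
        using ge[of j] \<open>?e j < ?e i\<close> by auto
    qed
  qed
  then have "Q m (selector x m)" if "x \<in> cyl ?q ?k" for x
    using i that by simp
  moreover have "?q \<in> cyl p m"
    using ge[of i] by (auto simp: mem_cyl_iff)
  ultimately show "\<exists>q k. m \<le> k \<and> q \<in> cyl p m \<and> (\<forall>x\<in>cyl q k. x \<notin> {x. \<not> (\<exists>n. Q n (selector x n))})"
    using ge[of i] by (intro exI[of _ ?q] exI[of _ ?k]) auto
qed

end

section \<open>Ultrafilters\<close>

text \<open>Zorn's lemma for families whose finite intersections are infinite, not merely nonempty;
  this makes the maximal family nonprincipal.\<close>

lemma ultrafilter_extension:
  assumes "\<And>\<F>. finite \<F> \<Longrightarrow> \<F> \<subseteq> B \<Longrightarrow> infinite (\<Inter>\<F>)"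
  obtains U where "ultrafilter U" "B \<subseteq> U"
proof -
  let ?fip = "\<lambda>G :: nat set set. \<forall>\<F>. finite \<F> \<longrightarrow> \<F> \<subseteq> G \<longrightarrow> infinite (\<Inter>\<F>)"
  have "\<exists>U\<in>{G. B \<subseteq> G \<and> ?fip G}. \<forall>G\<in>{G. B \<subseteq> G \<and> ?fip G}. U \<subseteq> G \<longrightarrow> G = U"
  proof (rule subset_Zorn_nonempty)
    show "{G. B \<subseteq> G \<and> ?fip G} \<noteq> {}"
      using assms by blast
  next
    fix C assume C: "C \<noteq> {}" "subset.chain {G. B \<subseteq> G \<and> ?fip G} C"
    have "infinite (\<Inter>\<F>)" if \<F>: "finite \<F>" "\<F> \<subseteq> \<Union>C" for \<F>
    proof -
      obtain G where "G \<in> C" "\<F> \<subseteq> G"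
        using finite_subset_Union_chain[OF \<F> C] by blast
      then show ?thesis
        using C(2) \<F>(1) by (auto simp: subset_chain_def)
    qed
    moreover have "B \<subseteq> \<Union>C"
    proof -
      obtain G where "G \<in> C" "B \<subseteq> G"
        using C by (auto simp: subset_chain_def)
      then show ?thesis by blast
    qed
    ultimately show "\<Union>C \<in> {G. B \<subseteq> G \<and> ?fip G}"
      by blast
  qed
  then obtain U where U: "B \<subseteq> U" "?fip U" and max: "\<And>G. U \<subseteq> G \<Longrightarrow> ?fip G \<Longrightarrow> G = U"
    by (smt (verit, best) mem_Collect_eq subset_trans)
  \<comment> \<open>Maximality in usable form: a set meeting all finite intersections from
    \<open>U\<close> in an infinite set can be adjoined, hence belongs to \<open>U\<close>.\<close>
  have mem: "a \<in> U" if a: "\<And>\<F>. finite \<F> \<Longrightarrow> \<F> \<subseteq> U \<Longrightarrow> infinite (a \<inter> \<Inter>\<F>)" for a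
  proof -
    have "infinite (\<Inter>\<F>)" if \<F>: "finite \<F>" "\<F> \<subseteq> insert a U" for \<F>
    proof -
      have "infinite (a \<inter> \<Inter>(\<F> - {a}))"
        using \<F> by (intro a) auto
      moreover have "a \<inter> \<Inter>(\<F> - {a}) \<subseteq> \<Inter>\<F>"
        by blast
      ultimately show ?thesis
        using finite_subset by blast
    qed
    then have "insert a U = U"
      by (intro max) auto
    then show ?thesis by blast
  qed
  have Int: "a \<inter> b \<in> U" if "a \<in> U" "b \<in> U" for a b
  proof (rule mem)
    fix \<F> assume "finite \<F>" "\<F> \<subseteq> U"
    then have "infinite (\<Inter>(insert a (insert b \<F>)))"
      using that U(2) by (metis finite_insert insert_subset)
    then show "infinite (a \<inter> b \<inter> \<Inter>\<F>)"
      by (simp add: Int_assoc)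
  qed
  have up: "b \<in> U" if "a \<in> U" "a \<subseteq> b" for a b
  proof (rule mem)
    fix \<F> assume "finite \<F>" "\<F> \<subseteq> U"
    then have "infinite (\<Inter>(insert a \<F>))"
      using that U(2) by (metis finite_insert insert_subset)
    moreover have "\<Inter>(insert a \<F>) \<subseteq> b \<inter> \<Inter>\<F>"
      using that(2) by auto
    ultimately show "infinite (b \<inter> \<Inter>\<F>)"
      using finite_subset by blast
  qed
  have inf: "infinite a" if "a \<in> U" for a
    using U(2)[rule_format, of "{a}"] that by simp
  have UNIV: "UNIV \<in> U"
    using mem[of UNIV] U(2) by simp
  have Inter: "\<Inter>\<F> \<in> U" if "finite \<F>" "\<F> \<subseteq> U" for \<F>
    using that by (induction) (auto simp: UNIV Int)
  have "a \<in> U \<or> - a \<in> U" for a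
  proof (rule ccontr)
    assume *: "\<not> (a \<in> U \<or> - a \<in> U)"
    then obtain F F' where F: "F \<in> U" "finite (a \<inter> F)" "F' \<in> U" "finite (- a \<inter> F')"
      using mem[of a] mem[of "- a"] Inter by metis
    have "F \<inter> F' \<subseteq> (a \<inter> F) \<union> (- a \<inter> F')"
      by blast
    then have "finite (F \<inter> F')"
      using F finite_subset by blast
    then show False
      using inf Int F by blast
  qed
  then have "ultrafilter U"
    unfolding ultrafilter_def using UNIV Int up inf by (auto simp: infsets_def)
  then show thesis
    using U(1) that by blast
qed

section \<open>The index order\<close>

text \<open>Stages are the sets of naturals themselves, in an initial well-order: there are
  continuum many, each with a small set of predecessors (\<open>small_underS\<close>).\<close>

abbreviation ord_le :: "nat set \<Rightarrow> nat set \<Rightarrow> bool" (infix "\<sqsubseteq>" 50) where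
  "a \<sqsubseteq> b \<equiv> (a, b) \<in> |UNIV :: nat set set|"

abbreviation ord_less :: "nat set \<Rightarrow> nat set \<Rightarrow> bool" (infix "\<sqsubset>" 50) where
  "a \<sqsubset> b \<equiv> a \<in> underS |UNIV :: nat set set| b"

abbreviation below :: "nat set \<Rightarrow> nat set set" where
  "below a \<equiv> underS |UNIV :: nat set set| a"

lemma ord_less_iff: "a \<sqsubset> b \<longleftrightarrow> a \<sqsubseteq> b \<and> a \<noteq> b"
  by (auto simp: underS_def)

lemma linorder_ord: "class.linorder (\<sqsubseteq>) (\<sqsubset>)"
proof -
  have "Well_order |UNIV :: nat set set|"
    by (rule card_of_Well_order)
  then have *: "Linear_order |UNIV :: nat set set|"
    by (simp add: well_order_on_def)
  then have "refl |UNIV :: nat set set|" "trans |UNIV :: nat set set|" "antisym |UNIV :: nat set set|"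
    "total |UNIV :: nat set set|"
    by (simp_all add: linear_order_on_def partial_order_on_def preorder_on_def Field_card_of)
  then show ?thesis
    by unfold_locales
      (unfold ord_less_iff, meson antisymD, meson UNIV_I refl_onD, meson transD, meson antisymD,
        metis UNIV_I refl_onD total_on_def)
qed

interpretation ord: linorder "(\<sqsubseteq>)" "(\<sqsubset>)"
  by (rule linorder_ord)

lemma wf_ord: "wf {(a, b). a \<sqsubset> b}"
proof -
  have "wf ( |UNIV :: nat set set| - Id)"
    using card_of_Well_order[of "UNIV :: nat set set"] by (simp add: well_order_on_def)
  moreover have "|UNIV :: nat set set| - Id = {(a, b). a \<sqsubset> b}"
    by (auto simp: ord_less_iff)
  ultimately show ?thesis by simp
qed

text \<open>The sets with least element \<open>to_nat t\<close> all carry tag \<open>t\<close>.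
  There are continuum many of them, so no \<open>below b\<close> contains them all. The tags will
  request cylinders cofinally often.\<close>

lemma cofinal_tagging: "\<exists>tag :: nat set \<Rightarrow> 't::countable. \<forall>t b. \<exists>c. b \<sqsubseteq> c \<and> tag c = t"
proof (rule exI[of _ "\<lambda>c. from_nat (LEAST n. n \<in> c)"], intro allI)
  fix t :: 't and b
  let ?g = "\<lambda>x. insert (to_nat t) ((+) (Suc (to_nat t)) ` x)"
  have "(LEAST n. n \<in> ?g x) = to_nat t" for x
    by (rule Least_equality) auto
  then have tag: "from_nat (LEAST n. n \<in> ?g x) = t" for x
    by simp
  have "inj ?g"
  proof (rule injI)
    fix x y assume "?g x = ?g y"
    then have "?g x - {to_nat t} = ?g y - {to_nat t}" by simp
    moreover have "?g x - {to_nat t} = (+) (Suc (to_nat t)) ` x" for x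
      by auto
    ultimately have "(+) (Suc (to_nat t)) ` x = (+) (Suc (to_nat t)) ` y"
      by simp
    then show "x = y"
      by (rule inj_image_eq_iff[THEN iffD1, rotated]) simp
  qed
  then have "\<not> range ?g \<subseteq> below b"
    using card_of_ordLeq[of "UNIV :: nat set set" "below b"] small_underS[of b] not_ordLess_ordLeq
    unfolding small_def by blast
  then obtain x where "\<not> ?g x \<sqsubset> b" by blast
  then have "b \<sqsubseteq> ?g x"
    using ord.not_less by blast
  then show "\<exists>c. b \<sqsubseteq> c \<and> from_nat (LEAST n. n \<in> c) = t"
    using tag by blast
qed

section \<open>Non-Menger products\<close>

text \<open>A Menger selection would give a function \<open>g\<close> such that every value of
  \<open>agree\<close> has, for some \<open>n\<close>, its entry of index \<open>n\<close> below
  \<open>g n\<close>. A set enumerated by a function above \<open>g\<close> is also a value, a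
  contradiction.\<close>

lemma not_Menger_space_prod:
  assumes inf: "\<And>a b. a \<in> P \<Longrightarrow> b \<in> Q \<Longrightarrow> infinite (agree a b)"
    and surj: "\<And>d. infinite d \<Longrightarrow> \<exists>a\<in>P. \<exists>b\<in>Q. agree a b = d"
  shows "\<not> Menger_space (prod_topology (subtopology cantor P) (subtopology cantor Q))"
proof
  let ?T = "prod_topology (subtopology cantor P) (subtopology cantor Q)"
  assume "Menger_space ?T"
  \<comment> \<open>Membership means that the entry of index \<open>n\<close> of
    \<open>agree a b\<close> is below \<open>m\<close>; for fixed \<open>n\<close> these sets
    increase with \<open>m\<close>.\<close>
  define O' where "O' = (\<lambda>n m. {(a, b) \<in> P \<times> Q. n < card (agree a b \<inter> {..<m})})"
  have top: "topspace ?T = P \<times> Q"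
    by (simp add: topspace_prod_topology)
  have "openin ?T (O' n m)" for n m
  proof (subst openin_subopen, intro ballI)
    fix z assume "z \<in> O' n m"
    then obtain a b where z: "z = (a, b)" "a \<in> P" "b \<in> Q" "n < card (agree a b \<inter> {..<m})"
      by (auto simp: O'_def)
    let ?W = "(cyl a m \<inter> P) \<times> (cyl b m \<inter> Q)"
    have "openin ?T ?W"
      unfolding openin_prod_Times_iff using openin_cyl openin_subtopology by blast
    moreover have *: "agree a' b' \<inter> {..<m} = agree a b \<inter> {..<m}" if "a' \<in> cyl a m" "b' \<in> cyl b m" for a' b'
      using that by (auto simp: agree_def mem_cyl_iff)
    have "?W \<subseteq> O' n m"
    proof
      fix w assume "w \<in> ?W"
      then obtain a' b' where "w = (a', b')" "a' \<in> P" "b' \<in> Q" "a' \<in> cyl a m" "b' \<in> cyl b m"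
        by auto
      then show "w \<in> O' n m"
        using z(4) *[of a' b'] by (simp add: O'_def)
    qed
    ultimately show "\<exists>W. openin ?T W \<and> z \<in> W \<and> W \<subseteq> O' n m"
      using z by (intro exI[of _ ?W]) simp
  qed
  moreover have "topspace ?T \<subseteq> \<Union>(range (O' n))" for n
  proof
    fix z assume "z \<in> topspace ?T"
    then obtain a b where z: "z = (a, b)" "a \<in> P" "b \<in> Q"
      using top by auto
    obtain D where D: "D \<subseteq> agree a b" "finite D" "card D = Suc n"
      using inf[OF z(2,3)] infinite_arbitrarily_large by metis
    obtain m where "D \<subseteq> {..<m}"
      using finite_nat_bounded[OF D(2)] by blast
    then have "Suc n \<le> card (agree a b \<inter> {..<m})"
      using D card_mono[of "agree a b \<inter> {..<m}" D] by auto
    then have "z \<in> O' n m"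
      using z by (simp add: O'_def)
    then show "z \<in> \<Union>(range (O' n))" by blast
  qed
  ultimately have "\<forall>n. open_cover ?T (range (O' n))"
    by (auto simp: open_cover_def)
  then obtain \<F> where \<F>: "\<And>n. finite (\<F> n)" "\<And>n. \<F> n \<subseteq> range (O' n)" "topspace ?T \<subseteq> \<Union>(\<Union>n. \<F> n)"
    using \<open>Menger_space ?T\<close> unfolding Menger_space_def by meson
  have "\<exists>g. \<forall>V\<in>\<F> n. \<exists>m\<le>g. V = O' n m" for n
  proof -
    obtain M where M: "finite M" "\<F> n = O' n ` M"
      using finite_subset_image[OF \<F>(1,2)] by blast
    obtain g where "\<forall>m\<in>M. m \<le> g"
      using M(1) finite_nat_set_iff_bounded_le by blast
    then show ?thesis
      using M(2) by (intro exI[of _ g]) auto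
  qed
  then obtain g where g: "\<And>n V. V \<in> \<F> n \<Longrightarrow> \<exists>m\<le>g n. V = O' n m"
    by metis
  \<comment> \<open>The sum gives \<open>g n \<le> e n\<close>, the summand \<open>n\<close> makes
    \<open>e\<close> strictly increasing.\<close>
  define e where "e = (\<lambda>n. n + (\<Sum>i\<le>n. g i))"
  have mono: "strict_mono e"
    by (rule strict_monoI_Suc) (simp add: e_def)
  then have "infinite (range e)"
    using range_inj_infinite strict_mono_imp_inj_on by blast
  then obtain a b where ab: "a \<in> P" "b \<in> Q" "agree a b = range e"
    using surj by blast
  then have "(a, b) \<in> topspace ?T"
    using top by simp
  then obtain n m where "(a, b) \<in> O' n m" "m \<le> g n"
    using \<F>(3) g by blast
  then have m: "n < card (range e \<inter> {..<m})" "m \<le> g n"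
    using ab by (auto simp: O'_def)
  have "range e \<inter> {..<m} \<subseteq> e ` {..<n}"
  proof
    fix k assume "k \<in> range e \<inter> {..<m}"
    then obtain j where j: "k = e j" "e j < m" by auto
    have "g n \<le> e n"
      unfolding e_def by (rule trans_le_add2) (rule member_le_sum, auto)
    then have "j < n"
      using j(2) m(2) strict_mono_less[OF mono, of j n] by linarith
    then show "k \<in> e ` {..<n}"
      using j(1) by blast
  qed
  then have "card (range e \<inter> {..<m}) \<le> card (e ` {..<n})"
    by (rule card_mono[rotated]) simp
  also have "\<dots> \<le> n"
    using card_image_le[of "{..<n}" e] by simp
  finally show False
    using m(1) by simp
qed

section \<open>Selections from Borel covers\<close>

definition good :: "nat set set \<Rightarrow> nat set set \<Rightarrow> (nat list \<times> nat) set \<Rightarrow> bool" where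
  "good V F T \<longleftrightarrow> F \<subseteq> V \<and> (\<forall>s\<in>T. \<not> meager (V \<inter> basic_cyl s))"

definition good_union :: "(nat \<Rightarrow> nat set set) \<Rightarrow> nat set set \<Rightarrow> (nat list \<times> nat) set \<Rightarrow> nat set set" where
  "good_union V F T = (\<Union>n\<in>{n. good (V n) F T}. V n)"

text \<open>Since \<open>T\<close> is arbitrary, goodness can be demanded on one cylinder more; the Baire property
  then turns non-meagerness on every cylinder into comeagerness, so a generic point extends \<open>F\<close>.\<close>

lemma comeager_good_union:
  assumes bp: "\<And>n. has_bp (V n)"
    and good: "\<And>s. \<exists>n. good (V n) F (insert s T)"
  shows "meager (- good_union V F T)"
proof (rule has_bp_comeager)
  show "has_bp (good_union V F T)"
    unfolding good_union_def by (intro has_bp_UNION bp) simp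
  fix p m
  obtain s where s: "cyl p m = basic_cyl s"
    using cyl_eq_basic_cyl by blast
  obtain n where "good (V n) F (insert s T)"
    using good by blast
  then have "V n \<inter> cyl p m \<subseteq> good_union V F T \<inter> cyl p m" "\<not> meager (V n \<inter> cyl p m)"
    by (auto simp: good_def good_union_def s)
  then show "\<not> meager (good_union V F T \<inter> cyl p m)"
    using meager_subset by blast
qed

text \<open>Used contrapositively: if such an \<open>x\<close> belongs to a coded set, the set is
  non-meager in every basic cylinder around \<open>x\<close>.\<close>

definition avoids_meager :: "nat set \<Rightarrow> nat set \<Rightarrow> bool" where
  "avoids_meager b x \<longleftrightarrow>
     (\<forall>n i s. meager (decode_family b n i \<inter> basic_cyl s) \<longrightarrow> x \<notin> decode_family b n i \<inter> basic_cyl s)"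

abbreviation selection :: "(nat set \<Rightarrow> nat \<Rightarrow> nat) \<Rightarrow> nat set \<Rightarrow> nat \<Rightarrow> nat set set" where
  "selection f b \<equiv> \<lambda>n. decode_family b n (f b n)"

text \<open>Only data of stages before \<open>a\<close> occur, so there are fewer than continuum
  many requirements. \<open>F\<close> accounts for the finite sets added to the scales.\<close>

definition absorbed :: "(nat set \<Rightarrow> nat set) \<Rightarrow> (nat set \<Rightarrow> nat \<Rightarrow> nat) \<Rightarrow> nat set \<Rightarrow> nat set \<Rightarrow> bool" where
  "absorbed z f a x \<longleftrightarrow> (\<forall>b\<in>below a. \<forall>J\<in>Fpow (below a). \<forall>F\<in>Fpow Fin. \<forall>T\<in>Fpow UNIV.
     meager (- good_union (selection f b) (z ` J \<union> F) T) \<longrightarrow> x \<in> good_union (selection f b) (z ` J \<union> F) T)"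

text \<open>\<open>J\<close> may contain \<open>a\<close> itself: the point of a stage is chosen
  before the selection function of that stage.\<close>

definition selects :: "(nat set \<Rightarrow> nat set) \<Rightarrow> nat set \<Rightarrow> (nat \<Rightarrow> nat) \<Rightarrow> bool" where
  "selects z a f \<longleftrightarrow> (\<forall>J\<in>Fpow (insert a (below a)). \<forall>F\<in>Fpow Fin. \<forall>T\<in>Fpow UNIV.
     (\<forall>n. \<exists>i. good (decode_family a n i) (z ` J \<union> F) T) \<longrightarrow>
     (\<exists>n. good (decode_family a n (f n)) (z ` J \<union> F) T))"

text \<open>The points of a finite set are added in increasing order of stages. Those up to the code
  stage \<open>b\<close> are handled at once by the selection function, later ones one at a time by
  \<open>absorbed\<close>.\<close>

lemma S1_borel_omega_generic:
  assumes avoids: "\<And>a b. b \<sqsubseteq> a \<Longrightarrow> avoids_meager b (z a)"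
    and absorbed: "\<And>a. absorbed z f a (z a)"
    and selects: "\<And>a. selects z a (f a)"
    and dense: "\<And>b s. \<exists>a. b \<sqsubseteq> a \<and> z a \<in> basic_cyl s"
    and A: "A \<subseteq> Fin"
  shows "S1_borel_omega (subtopology cantor (range z \<union> A))"
  unfolding S1_borel_omega_def
proof (intro allI impI)
  let ?X = "range z \<union> A"
  fix \<U> :: "nat \<Rightarrow> nat set set set"
  assume \<U>: "\<forall>n. borel_omega_cover (subtopology cantor ?X) (\<U> n)"
  have ex: "\<exists>V\<in>\<U> n. F \<subseteq> V" if "finite F" "F \<subseteq> ?X" for n F
    using \<U> that by (simp add: borel_omega_cover_def)
  define V where "V = (\<lambda>n. from_nat_into (\<U> n))"
  have "\<U> n \<noteq> {}" "countable (\<U> n)" for n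
    using ex[of "{}" n] \<U> by (auto simp: borel_omega_cover_def)
  then have V: "range (V n) = \<U> n" for n
    unfolding V_def by (rule range_from_nat_into)
  have "\<exists>c. V n i = decode_borel c \<inter> ?X" for n i
  proof -
    have "V n i \<in> \<U> n" using V by blast
    then have "V n i \<in> borel_sets_of (subtopology cantor ?X)"
      using \<U> by (auto simp: borel_omega_cover_def)
    then show ?thesis by (rule borel_subtopology_imp_borel_code)
  qed
  then obtain c where "\<And>n i. V n i = decode_borel (c n i) \<inter> ?X"
    by metis
  then obtain b where b: "\<And>n i. V n i = decode_family b n i \<inter> ?X"
    using decode_family_surj[of c] by metis
  \<comment> \<open>Before any selection, \<open>F\<close> is enlarged by a point of stage at least
    \<open>b\<close> in each cylinder of \<open>T\<close>. Some member of the cover contains them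
    all, and these points witness its non-meagerness.\<close>
  have start: "\<exists>i. good (decode_family b n i) F T"
    if F: "finite F" "F \<subseteq> ?X" and T: "finite T" for n F T
  proof -
    obtain a where a: "\<And>s. b \<sqsubseteq> a s" "\<And>s. z (a s) \<in> basic_cyl s"
      using dense[of b] by metis
    have "finite (F \<union> (\<lambda>s. z (a s)) ` T)" "F \<union> (\<lambda>s. z (a s)) ` T \<subseteq> ?X"
      using F T by auto
    from ex[OF this, of n] obtain i where i: "F \<union> (\<lambda>s. z (a s)) ` T \<subseteq> decode_family b n i"
      using V[of n] b by (metis Int_subset_iff rangeE)
    have "\<not> meager (decode_family b n i \<inter> basic_cyl s)" if "s \<in> T" for s
    proof -
      have "z (a s) \<in> decode_family b n i \<inter> basic_cyl s"
        using i that a(2) by blast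
      then show ?thesis
        using avoids[OF a(1)[of s]] unfolding avoids_meager_def by blast
    qed
    then show ?thesis
      using i by (auto simp: good_def)
  qed
  let ?W = "selection f b"
  have Fin: "F \<in> Fpow Fin" if "F \<in> Fpow A" for F
    using that Fpow_mono[OF A] by blast
  have base: "\<exists>n. good (?W n) (z ` J \<union> F) T"
    if "J \<in> Fpow (insert b (below b))" "F \<in> Fpow A" "finite T" for J F T
  proof (rule selects[of b, unfolded selects_def, rule_format])
    show "\<exists>i. good (decode_family b n i) (z ` J \<union> F) T" for n
      using that by (intro start) (auto simp: Fpow_def)
  qed (use that Fin in \<open>auto simp: Fpow_def\<close>)
  \<comment> \<open>\<open>T\<close> stays quantified in the induction, because
    \<open>comeager_good_union\<close> consumes the hypothesis for one more cylinder.\<close>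
  have "\<forall>F T. F \<in> Fpow A \<longrightarrow> finite T \<longrightarrow> (\<exists>n. good (?W n) (z ` J \<union> F) T)" if "finite J" for J
    using that
  proof (induction J rule: ord.finite_linorder_max_induct)
    case empty
    then show ?case
      using base[of "{}"] by (simp add: Fpow_def)
  next
    case (insert a J)
    show ?case
    proof (intro allI impI)
      fix F T assume F: "F \<in> Fpow A" and T: "finite (T :: (nat list \<times> nat) set)"
      show "\<exists>n. good (?W n) (z ` insert a J \<union> F) T"
      proof (cases "a \<sqsubseteq> b")
        case True
        have "j \<sqsubset> b" if "j \<in> J" for j
          using insert.hyps(2) that ord.less_le_trans[OF _ True] by blast
        then have "insert a J \<in> Fpow (insert b (below b))"
          using True insert.hyps(1) by (auto simp: Fpow_def ord_less_iff)
        then show ?thesis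
          using F T by (rule base)
      next
        case False
        have "z a \<in> good_union ?W (z ` J \<union> F) T"
        proof (rule absorbed[of a, unfolded absorbed_def, rule_format])
          show "b \<sqsubset> a"
            using False ord.not_le by blast
          show "J \<in> Fpow (below a)"
            using insert.hyps by (auto simp: Fpow_def)
          show "meager (- good_union ?W (z ` J \<union> F) T)"
            using insert.IH F T by (intro comeager_good_union has_bp_decode_family) simp
        qed (use Fin F T in \<open>auto simp: Fpow_def\<close>)
        then show ?thesis
          by (auto simp: good_union_def good_def)
      qed
    qed
  qed
  note cover = this
  have "\<exists>n. F \<subseteq> V n (f b n)" if F: "finite F" "F \<subseteq> ?X" for F
  proof -
    obtain J where J: "finite J" "F \<inter> range z = z ` J"
      using finite_subset_image[of "F \<inter> range z" z UNIV] F(1) by auto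
    have "F \<inter> A \<in> Fpow A"
      using F(1) by (simp add: Fpow_def)
    then obtain n where "good (?W n) (z ` J \<union> (F \<inter> A)) {}"
      using cover[OF J(1)] by blast
    moreover have "F = z ` J \<union> (F \<inter> A)"
      unfolding J(2)[symmetric] using F(2) by auto
    ultimately have "F \<subseteq> ?W n"
      by (simp add: good_def)
    then have "F \<subseteq> V n (f b n)"
      unfolding b using F(2) by (rule Int_greatest)
    then show ?thesis ..
  qed
  moreover have mem: "V n (f b n) \<in> \<U> n" for n
    using V by blast
  moreover have "V n (f b n) \<in> borel_sets_of (subtopology cantor ?X)" for n
    using \<U>[rule_format, of n] mem[of n] by (auto simp: borel_omega_cover_def)
  moreover have "?X \<notin> range (\<lambda>n. V n (f b n))"
  proof
    assume "?X \<in> range (\<lambda>n. V n (f b n))"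
    then obtain n where "?X \<in> \<U> n"
      by (elim rangeE) (metis mem)
    then show False
      using \<U>[rule_format, of n] by (simp add: borel_omega_cover_def)
  qed
  ultimately have "borel_omega_cover (subtopology cantor ?X) (range (\<lambda>n. V n (f b n)))"
    unfolding borel_omega_cover_def by (intro conjI) auto
  with mem show "\<exists>V. (\<forall>n. V n \<in> \<U> n) \<and> borel_omega_cover (subtopology cantor ?X) (range V)"
    by (intro exI[of _ "\<lambda>n. V n (f b n)"]) simp
qed

section \<open>Scales\<close>

text \<open>For finite \<open>J\<close> these are the finite intersections that must be infinite for
  the ultrafilter to exist.\<close>

definition dominated_set :: "(nat set \<Rightarrow> nat set) \<Rightarrow> (nat set \<times> nat set) set \<Rightarrow> nat set" where
  "dominated_set z J = {n. \<forall>(b, c)\<in>J. enumerate b n \<le> enumerate (z c) n}"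

text \<open>\<open>K\<close> may contain \<open>a\<close>, which is how the point of a stage comes
  to dominate the set indexing that stage.\<close>

definition dominates :: "(nat set \<Rightarrow> nat set) \<Rightarrow> nat set \<Rightarrow> nat set \<Rightarrow> bool" where
  "dominates z a x \<longleftrightarrow> (\<forall>J\<in>Fpow (below a \<times> below a). \<forall>K\<in>Fpow (insert a (below a)).
     infinite (dominated_set z J) \<longrightarrow>
     infinite {n \<in> dominated_set z J. \<forall>b\<in>K. enumerate b n \<le> enumerate x n})"

text \<open>Induction on the largest second component \<open>a\<close>: the pairs ending in
  \<open>a\<close> supply \<open>K\<close>, the others lie below \<open>a\<close>, and
  \<open>dominates\<close> at \<open>a\<close> keeps the intersection infinite.\<close>

lemma infinite_dominated_set:
  assumes dom: "\<And>a. dominates z a (z a)"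
    and J: "finite J" "\<And>b c. (b, c) \<in> J \<Longrightarrow> b \<sqsubseteq> c"
  shows "infinite (dominated_set z J)"
proof -
  have "\<forall>J. finite J \<longrightarrow> snd ` J \<subseteq> C \<longrightarrow> (\<forall>(b, c)\<in>J. b \<sqsubseteq> c) \<longrightarrow> infinite (dominated_set z J)"
    if "finite C" for C
    using that
  proof (induction C rule: ord.finite_linorder_max_induct)
    case empty
    then show ?case by (simp add: dominated_set_def)
  next
    case (insert a C)
    show ?case
    proof (intro allI impI)
      fix J assume J: "finite J" "snd ` J \<subseteq> insert a C" "\<forall>(b, c)\<in>J. b \<sqsubseteq> c"
      let ?J = "{p \<in> J. snd p \<noteq> a}" and ?K = "fst ` {p \<in> J. snd p = a}"
      have C: "c \<sqsubset> a" if "c \<in> C" for c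
        using insert.hyps that by blast
      have "snd ` ?J \<subseteq> C" "\<forall>(b, c)\<in>?J. b \<sqsubseteq> c"
        using J by auto
      then have inf: "infinite (dominated_set z ?J)"
        using insert.IH J(1) by (metis (no_types, lifting) finite_subset mem_Collect_eq subsetI)
      have "?J \<subseteq> below a \<times> below a"
      proof
        fix p assume p: "p \<in> ?J"
        then have "snd p \<sqsubset> a"
          using C \<open>snd ` ?J \<subseteq> C\<close> by blast
        moreover have "fst p \<sqsubseteq> snd p"
          using p J(3) by auto
        ultimately show "p \<in> below a \<times> below a"
          by (metis mem_Times_iff ord.le_less_trans)
      qed
      moreover have "?K \<subseteq> insert a (below a)"
        using J(3) by (force simp: ord_less_iff)
      ultimately have "?J \<in> Fpow (below a \<times> below a)" "?K \<in> Fpow (insert a (below a))"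
        using J(1) by (simp_all add: Fpow_def)
      then have "infinite {n \<in> dominated_set z ?J. \<forall>b\<in>?K. enumerate b n \<le> enumerate (z a) n}"
        using dom[of a] inf unfolding dominates_def by blast
      moreover have "{n \<in> dominated_set z ?J. \<forall>b\<in>?K. enumerate b n \<le> enumerate (z a) n} \<subseteq> dominated_set z J"
        by (force simp: dominated_set_def)
      ultimately show "infinite (dominated_set z J)"
        using finite_subset by blast
    qed
  qed
  from this[of "snd ` J"] show ?thesis
    using J by blast
qed

lemma ultrafilter_le_mod:
  assumes "\<And>a. dominates z a (z a)"
  obtains U where "ultrafilter U" "\<And>a b. b \<sqsubseteq> a \<Longrightarrow> le_mod U b (z a)"
proof -
  let ?D = "\<lambda>p. {n. enumerate (fst p) n \<le> enumerate (z (snd p)) n}"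
  have "infinite (\<Inter>\<F>)" if "finite \<F>" "\<F> \<subseteq> ?D ` {(b, a). b \<sqsubseteq> a}" for \<F>
  proof -
    from finite_subset_image[OF that]
    obtain J where J: "finite J" "J \<subseteq> {(b, a). b \<sqsubseteq> a}" "\<F> = ?D ` J"
      by blast
    have "\<Inter>\<F> = dominated_set z J"
      unfolding J(3) dominated_set_def case_prod_beta by auto
    then show ?thesis
      using infinite_dominated_set[OF assms J(1)] J(2) by auto
  qed
  then obtain U where U: "ultrafilter U" "?D ` {(b, a). b \<sqsubseteq> a} \<subseteq> U"
    using ultrafilter_extension[of "?D ` {(b, a). b \<sqsubseteq> a}"] by blast
  have "le_mod U b (z a)" if "b \<sqsubseteq> a" for a b
    using U(2) that unfolding le_mod_def by force
  with U(1) show thesis by (rule that)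
qed

context cov_meager_continuum
begin

lemma U_scale_range:
  assumes U: "ultrafilter U" "\<And>a b. b \<sqsubseteq> a \<Longrightarrow> le_mod U b (z a)"
    and inf: "range z \<subseteq> infsets"
  shows "U_scale U (range z)"
proof -
  have Int: "\<And>a b. a \<in> U \<Longrightarrow> b \<in> U \<Longrightarrow> a \<inter> b \<in> U" and nempty: "{} \<notin> U"
    using U(1) unfolding ultrafilter_def infsets_def by auto
  have "\<not> (\<exists>b\<in>infsets. \<forall>a\<in>range z. le_mod U a b)"
  proof
    assume "\<exists>b\<in>infsets. \<forall>a\<in>range z. le_mod U a b"
    then obtain b where b: "infinite b" "\<And>a. le_mod U (z a) b"
      by (auto simp: infsets_def)
    \<comment> \<open>Dropping the minimum of a supposed bound \<open>b\<close> raises every entry;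
      \<open>z ?c\<close> is above \<open>?c\<close> modulo \<open>U\<close>, so it cannot be below
      \<open>b\<close>.\<close>
    let ?c = "b - {enumerate b 0}"
    have "{n. enumerate ?c n \<le> enumerate (z ?c) n} \<inter> {n. enumerate (z ?c) n \<le> enumerate b n} \<in> U"
      using U(2)[OF ord.order.refl] b(2) by (intro Int) (auto simp: le_mod_def)
    moreover have "{n. enumerate ?c n \<le> enumerate (z ?c) n} \<inter> {n. enumerate (z ?c) n \<le> enumerate b n} = {}"
    proof -
      have "enumerate b n < enumerate ?c n" for n
        by (metis enumerate_step[OF b(1)] enumerate_Suc')
      then have "\<not> (enumerate ?c n \<le> k \<and> k \<le> enumerate b n)" for n k
        using leD order_trans by blast
      then show ?thesis by blast
    qed
    ultimately show False
      using nempty by simp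
  qed
  then have unb: "unbounded_mod U (range z)"
    using inf by (simp add: unbounded_mod_def)
  \<comment> \<open>A small family is bounded in the index order, hence by a single
    \<open>z a\<close> modulo \<open>U\<close>; so \<open>bounding_number U\<close> is at least the
    continuum.\<close>
  have not_small: "\<not> small B" if B: "unbounded_mod U B" for B
  proof
    assume "small B"
    then obtain a where "\<forall>b\<in>B. b \<sqsubseteq> a"
      using small_bounded by blast
    then have "\<forall>b\<in>B. le_mod U b (z a)"
      using U(2) by blast
    then show False
      using B inf unfolding unbounded_mod_def by blast
  qed
  obtain B where B: "unbounded_mod U B" "bounding_number U = |B|"
    and min: "\<And>C. unbounded_mod U C \<Longrightarrow> bounding_number U \<le>o |C|"
    using least_card_attained[of "unbounded_mod U", OF unb] unfolding bounding_number_def by metis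
  have "|UNIV :: nat set set| \<le>o bounding_number U"
    unfolding B(2) using not_small[OF B(1)] unfolding small_def
    by (metis card_of_Well_order ordLess_or_ordLeq)
  then have less: "|S| <o bounding_number U" if "small S" for S :: "nat set set"
    using that ordLess_ordLeq_trans unfolding small_def by blast
  have "\<exists>c\<in>infsets. \<exists>S\<subseteq>range z. |S| <o bounding_number U \<and>
      (\<forall>x\<in>range z - S. le_mod (positive_sets U) d c \<and> le_mod U c x)" if "d \<in> infsets" for d
  \<comment> \<open>The scale condition holds with \<open>d\<close> itself as \<open>c\<close>; the
    exceptions are the points of stages before \<open>d\<close>.\<close>
  proof (intro bexI[of _ d] exI[of _ "z ` below d"] conjI ballI)
    show "|z ` below d| <o bounding_number U"
      by (intro less small_image small_underS)
    show "le_mod (positive_sets U) d d"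
      using nempty by (simp add: le_mod_def positive_sets_def)
    fix x assume "x \<in> range z - z ` below d"
    then obtain a where "x = z a" "\<not> a \<sqsubset> d" by blast
    then show "le_mod U d x"
      using U(2) ord.not_less by blast
  qed (use that in auto)
  then show ?thesis
    unfolding U_scale_def using inf min[OF unb] by blast
qed

end

section \<open>The generic construction\<close>

text \<open>Together with \<open>generic_at_cong\<close> this gives the locality that well-founded
  choice demands.\<close>

lemma selects_cong:
  assumes "\<And>b. b \<sqsubseteq> a \<Longrightarrow> z b = z' b"
  shows "selects z a f = selects z' a f"
proof -
  have "z ` J = z' ` J" if "J \<in> Fpow (insert a (below a))" for J
    using that assms by (intro image_cong) (auto simp: Fpow_def ord_less_iff)
  then show ?thesis
    by (simp add: selects_def)
qed

text \<open>\<open>w\<close> is the companion sequence. An infinite complement ensures infinite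
  agreement with the members of \<open>Fin\<close>.\<close>

definition generic_at ::
  "(nat set \<Rightarrow> nat set) \<Rightarrow> (nat set \<Rightarrow> nat \<Rightarrow> nat) \<Rightarrow> (nat set \<Rightarrow> nat set) \<Rightarrow> nat set \<Rightarrow> nat set \<Rightarrow> bool" where
  "generic_at z f w a x \<longleftrightarrow> infinite x \<and> infinite (- x) \<and> (\<forall>b\<in>below a. infinite (agree x (w b))) \<and>
     (\<forall>b\<in>insert a (below a). avoids_meager b x) \<and> absorbed z f a x \<and> dominates z a x"

lemma generic_at_cong:
  assumes z: "\<And>b. b \<sqsubset> a \<Longrightarrow> z b = z' b" and f: "\<And>b. b \<sqsubset> a \<Longrightarrow> f b = f' b"
    and w: "\<And>b. b \<sqsubset> a \<Longrightarrow> w b = w' b"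
  shows "generic_at z f w a x = generic_at z' f' w' a x"
proof -
  have zJ: "z ` J = z' ` J" if "J \<in> Fpow (below a)" for J
    using that z by (intro image_cong) (auto simp: Fpow_def)
  have "dominated_set z J = dominated_set z' J" if "J \<in> Fpow (below a \<times> below a)" for J
  proof -
    have "z (snd p) = z' (snd p)" if "p \<in> J" for p
      using that \<open>J \<in> _\<close> by (intro z) (auto simp: Fpow_def)
    then show ?thesis
      unfolding dominated_set_def by (force simp: case_prod_beta)
  qed
  then have "dominates z a x = dominates z' a x"
    by (simp add: dominates_def)
  moreover have "absorbed z f a x = absorbed z' f' a x"
    unfolding absorbed_def using f by (intro ball_cong refl) (simp add: zJ)
  ultimately show ?thesis
    unfolding generic_at_def using w by simp
qed

section \<open>Genericity of the requirements of one stage\<close>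

context cov_meager_continuum
begin

lemma countable_Fin: "countable Fin"
  unfolding Fin_def by (simp add: countable_Collect_finite)

lemma small_Fpow_Fin: "small (Fpow Fin)"
  by (intro small_countable countable_Fpow countable_Fin)

lemma small_Fpow_countable: "small (Fpow (UNIV :: 'a::countable set))"
  by (intro small_countable countable_Fpow) simp

lemma generically_avoids_meager: "generically (avoids_meager b)"
  unfolding avoids_meager_def
  by (intro generically_all generically_imp generically_comeager) (simp only: not_not Collect_mem_eq)

lemma generically_absorbed: "generically (absorbed z f a)"
  unfolding absorbed_def
  by (intro generically_ball generically_imp generically_comeager small_underS small_Fpow
      small_Fpow_Fin small_Fpow_countable) (simp add: Compl_eq)

lemma generically_dominates: "generically (dominates z a)"
  unfolding dominates_def
proof (intro generically_ball generically_imp small_underS small_Fpow small_Times small_insert)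
  fix J K assume J: "infinite (dominated_set z J)" and K: "K \<in> Fpow (insert a (below a))"
  \<comment> \<open>The sum over \<open>K\<close> is one function above the enumerations of all
    members of \<open>K\<close>.\<close>
  have "generically (\<lambda>x. infinite {n \<in> dominated_set z J. (\<Sum>b\<in>K. enumerate b n) \<le> enumerate x n})"
    by (rule generically_enumerate_ge[OF J])
  then show "generically (\<lambda>x. infinite {n \<in> dominated_set z J. \<forall>b\<in>K. enumerate b n \<le> enumerate x n})"
  proof (rule generically_mono)
    fix x assume *: "infinite {n \<in> dominated_set z J. (\<Sum>b\<in>K. enumerate b n) \<le> enumerate x n}"
    have "enumerate b n \<le> (\<Sum>b\<in>K. enumerate b n)" if "b \<in> K" for b n
      using that K by (intro member_le_sum) (auto simp: Fpow_def)
    then have "{n \<in> dominated_set z J. (\<Sum>b\<in>K. enumerate b n) \<le> enumerate x n}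
        \<subseteq> {n \<in> dominated_set z J. \<forall>b\<in>K. enumerate b n \<le> enumerate x n}"
      using order_trans by blast
    with * show "infinite {n \<in> dominated_set z J. \<forall>b\<in>K. enumerate b n \<le> enumerate x n}"
      using finite_subset by blast
  qed
qed

lemma generically_generic_at: "generically (generic_at z f w a)"
  unfolding generic_at_def
  \<comment> \<open>Agreement with \<open>UNIV\<close> is \<open>x\<close> and agreement with
    \<open>{}\<close> is \<open>- x\<close>, which covers both infinity requirements.\<close>
  using generically_infinite_agree[of UNIV] generically_infinite_agree[of "{}"]
  by (intro generically_conj generically_ball small_insert small_underS generically_infinite_agree
      generically_avoids_meager generically_absorbed generically_dominates) simp_all

lemma generically_selects: "generically (\<lambda>x. selects z a (selector x))"
  unfolding selects_def
  by (intro generically_ball generically_imp generically_selector small_insert small_underS small_Fpow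
      small_Fpow_Fin small_Fpow_countable) blast

end

context cov_meager_continuum
begin

text \<open>Well-founded choice of a point and a selection function at each stage. Translates of
  generic sets are generic, so one set can meet the requirements of both sequences, and one
  selection function serves both.\<close>

lemma generic_sequences:
  fixes D :: "nat set \<Rightarrow> nat set"
  obtains x f where
    "\<And>a. generic_at x f (\<lambda>b. agree (x b) (D b)) a (x a)"
    "\<And>a. generic_at (\<lambda>b. agree (x b) (D b)) f x a (agree (x a) (D a))"
    "\<And>a. selects x a (f a)"
    "\<And>a. selects (\<lambda>b. agree (x b) (D b)) a (f a)"
    "\<And>b s. \<exists>a. b \<sqsubseteq> a \<and> x a \<in> basic_cyl s"
    "\<And>b s. \<exists>a. b \<sqsubseteq> a \<and> agree (x a) (D a) \<in> basic_cyl s"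
proof -
  obtain tag :: "nat set \<Rightarrow> bool \<times> nat list \<times> nat" where tag: "\<And>t b. \<exists>c. b \<sqsubseteq> c \<and> tag c = t"
    using cofinal_tagging by metis
  define X where "X = (\<lambda>h :: nat set \<Rightarrow> nat set \<times> (nat \<Rightarrow> nat). \<lambda>b. fst (h b))"
  define Y where "Y = (\<lambda>h :: nat set \<Rightarrow> nat set \<times> (nat \<Rightarrow> nat). \<lambda>b. agree (fst (h b)) (D b))"
  define S where "S = (\<lambda>h :: nat set \<Rightarrow> nat set \<times> (nat \<Rightarrow> nat). \<lambda>b. snd (h b))"
  \<comment> \<open>The updates at \<open>a\<close> insert the new point, since
    \<open>selects\<close> also refers to stage \<open>a\<close>. The tag names the sequence and the
    cylinder that its point must enter.\<close>
  define P where "P = (\<lambda>h a p.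
    generic_at (X h) (S h) (Y h) a (fst p) \<and> generic_at (Y h) (S h) (X h) a (agree (fst p) (D a)) \<and>
    selects ((X h)(a := fst p)) a (snd p) \<and> selects ((Y h)(a := agree (fst p) (D a))) a (snd p) \<and>
    (if fst (tag a) then fst p else agree (fst p) (D a)) \<in> basic_cyl (snd (tag a)))"
  have "\<exists>h. \<forall>a. P h a (h a)"
  proof (rule dependent_wf_choice[OF wf_ord])
    fix h h' :: "nat set \<Rightarrow> nat set \<times> (nat \<Rightarrow> nat)" and a p
    assume "\<And>b. (b, a) \<in> {(a, b). a \<sqsubset> b} \<Longrightarrow> h b = h' b"
    then have eq: "X h b = X h' b" "Y h b = Y h' b" "S h b = S h' b" if "b \<sqsubset> a" for b
      using that by (simp_all add: X_def Y_def S_def)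
    have "((X h)(a := u)) b = ((X h')(a := u)) b" "((Y h)(a := u)) b = ((Y h')(a := u)) b"
      if "b \<sqsubseteq> a" for b u
      using that eq by (auto simp: ord_less_iff)
    then have "selects ((X h)(a := u)) a g = selects ((X h')(a := u)) a g"
      "selects ((Y h)(a := u)) a g = selects ((Y h')(a := u)) a g" for u g
      by (intro selects_cong; blast)+
    moreover have "generic_at (X h) (S h) (Y h) a u = generic_at (X h') (S h') (Y h') a u"
      "generic_at (Y h) (S h) (X h) a u = generic_at (Y h') (S h') (X h') a u" for u
      by (intro generic_at_cong eq; assumption)+
    ultimately show "P h a p = P h' a p"
      unfolding P_def by simp
  next
    fix a and h :: "nat set \<Rightarrow> nat set \<times> (nat \<Rightarrow> nat)"
    obtain l m where lm: "snd (tag a) = (l, m)"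
      by fastforce
    \<comment> \<open>A cylinder requested for the translated sequence is translated back.\<close>
    define p where "p = (if fst (tag a) then set l else agree (set l) (D a))"
    have "generically (\<lambda>x. generic_at (X h) (S h) (Y h) a x \<and> generic_at (Y h) (S h) (X h) a (agree x (D a)))"
      by (intro generically_conj generically_generic_at
          generically_agree[of "generic_at (Y h) (S h) (X h) a"])
    from generically_exists[OF this, of p m] obtain x where x: "x \<in> cyl p m"
      "generic_at (X h) (S h) (Y h) a x" "generic_at (Y h) (S h) (X h) a (agree x (D a))"
      by blast
    have "(if fst (tag a) then x else agree x (D a)) \<in> basic_cyl (snd (tag a))"
      using x(1) agree_mem_cyl_iff[of x "D a" p m] by (simp add: basic_cyl_def lm p_def split: if_splits)
    moreover have "generically (\<lambda>s. selects ((X h)(a := x)) a (selector s) \<and>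
        selects ((Y h)(a := agree x (D a))) a (selector s))"
      by (intro generically_conj generically_selects)
    from generically_exists[OF this, of "{}" 0] obtain s where
      "selects ((X h)(a := x)) a (selector s)" "selects ((Y h)(a := agree x (D a))) a (selector s)"
      by blast
    ultimately have "P h a (x, selector s)"
      unfolding P_def fst_conv snd_conv using x(2,3) by blast
    then show "\<exists>p. P h a p" ..
  qed
  then obtain h where h: "\<And>a. P h a (h a)"
    by blast
  have upd: "(X h)(a := fst (h a)) = X h" "(Y h)(a := agree (fst (h a)) (D a)) = Y h" for a
    by (simp_all add: X_def Y_def fun_upd_idem)
  have Y: "(\<lambda>b. agree (X h b) (D b)) = Y h"
    by (simp add: X_def Y_def)
  have fst: "fst (h a) = X h a" and snd: "snd (h a) = S h a" for a
    by (simp_all add: X_def S_def)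
  note h' = h[unfolded P_def upd, unfolded fst snd]
  show thesis
  proof (rule that[of "X h" "S h", unfolded Y])
    fix b s
    show "\<exists>a. b \<sqsubseteq> a \<and> X h a \<in> basic_cyl s"
      using tag[of b "(True, s)"] h' by (metis fst_conv snd_conv)
    show "\<exists>a. b \<sqsubseteq> a \<and> agree (X h a) (D a) \<in> basic_cyl s"
      using tag[of b "(False, s)"] h' by (metis fst_conv snd_conv)
  qed (use h' Y in \<open>simp_all\<close>)
qed

end

theorem theorem5p1:
  assumes "cov_meager =o continuum"
    and "regularCard continuum"
  shows "\<exists>U U' X Y. ultrafilter U \<and> ultrafilter U' \<and> U_scale U X \<and> U_scale U' Y \<and>
    S1_borel_omega (subtopology cantor (X \<union> Fin)) \<and>
    S1_borel_omega (subtopology cantor (Y \<union> Fin)) \<and>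
    \<not> Menger_space (prod_topology (subtopology cantor (X \<union> Fin)) (subtopology cantor (Y \<union> Fin))) \<and>
    S1_borel_omega (subtopology cantor X) \<and>
    S1_borel_omega (subtopology cantor Y) \<and>
    \<not> Menger_space (prod_topology (subtopology cantor X) (subtopology cantor Y))"
proof -
  interpret cov_meager_continuum
    using assms by unfold_locales
  \<comment> \<open>Sending finite indices to \<open>UNIV\<close> makes all values infinite, while
    every infinite set is its own value.\<close>
  define D where "D = (\<lambda>a :: nat set. if finite a then UNIV else a)"
  obtain x f where xf: "\<And>a. generic_at x f (\<lambda>b. agree (x b) (D b)) a (x a)"
    "\<And>a. generic_at (\<lambda>b. agree (x b) (D b)) f x a (agree (x a) (D a))"
    "\<And>a. selects x a (f a)"
    "\<And>a. selects (\<lambda>b. agree (x b) (D b)) a (f a)"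
    "\<And>b s. \<exists>a. b \<sqsubseteq> a \<and> x a \<in> basic_cyl s"
    "\<And>b s. \<exists>a. b \<sqsubseteq> a \<and> agree (x a) (D a) \<in> basic_cyl s"
    by (rule generic_sequences[of D]) blast
  define y where "y = (\<lambda>b. agree (x b) (D b))"
  have gx: "generic_at x f y a (x a)" and gy: "generic_at y f x a (y a)" for a
    using xf(1,2) by (simp_all add: y_def)
  \<comment> \<open>\<open>A\<close> will be \<open>Fin\<close> and the empty set, for the two
    versions of the conclusion.\<close>
  have S1: "S1_borel_omega (subtopology cantor (range z \<union> A))"
    if "\<And>a. generic_at z f w a (z a)" "\<And>a. selects z a (f a)"
      "\<And>b s. \<exists>a. b \<sqsubseteq> a \<and> z a \<in> basic_cyl s" "A \<subseteq> Fin" for z w A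
  proof (rule S1_borel_omega_generic)
    show "avoids_meager b (z a)" if "b \<sqsubseteq> a" for a b
      using \<open>\<And>a. generic_at z f w a (z a)\<close>[of a] that by (auto simp: generic_at_def ord_less_iff)
    show "absorbed z f a (z a)" for a
      using that(1) by (simp add: generic_at_def)
  qed (use that in auto)
  have x: "S1_borel_omega (subtopology cantor (range x \<union> A))" if "A \<subseteq> Fin" for A
    using gx xf(3,5) that by (rule S1)
  have y: "S1_borel_omega (subtopology cantor (range y \<union> A))" if "A \<subseteq> Fin" for A
    by (rule S1[OF gy]) (use xf(4,6) that in \<open>simp_all add: y_def\<close>)
  have "\<And>a. dominates x a (x a)" "\<And>a. dominates y a (y a)"
    using gx gy by (simp_all add: generic_at_def)
  then obtain U U' where U: "ultrafilter U" "\<And>a b. b \<sqsubseteq> a \<Longrightarrow> le_mod U b (x a)"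
    and U': "ultrafilter U'" "\<And>a b. b \<sqsubseteq> a \<Longrightarrow> le_mod U' b (y a)"
    using ultrafilter_le_mod by metis
  have inf: "range x \<subseteq> infsets" "range y \<subseteq> infsets"
    using gx gy by (auto simp: generic_at_def infsets_def)
  have co_inf: "infinite (agree (z a) F)" if "generic_at z f w a (z a)" "finite F" for z w a F
  proof -
    have "infinite (- z a - F)"
      using that by (simp add: generic_at_def)
    moreover have "- z a - F \<subseteq> agree (z a) F"
      by (auto simp: agree_def)
    ultimately show ?thesis
      using finite_subset by blast
  qed
  have xy: "agree (x a) (y a) = D a" for a
    by (simp add: y_def)
  \<comment> \<open>At equal stages the value is \<open>D a\<close>; otherwise the later of the two
    points is generic over the earlier one.\<close>
  have "infinite (agree (x a) (y b))" for a b
  proof -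
    consider "a = b" | "a \<sqsubset> b" | "b \<sqsubset> a"
      using ord.less_linear by blast
    then show ?thesis
    proof cases
      case 1
      then show ?thesis by (simp add: xy D_def)
    next
      case 2
      then show ?thesis
        using gy[of b] agree_commute by (simp add: generic_at_def)
    next
      case 3
      then show ?thesis
        using gx[of a] by (simp add: generic_at_def)
    qed
  qed
  moreover have "infinite (agree F G)" if "finite F" "finite G" for F G :: "nat set"
  proof -
    have "infinite (- (F \<union> G))"
      using that by (simp add: Compl_eq_Diff_UNIV)
    moreover have "- (F \<union> G) \<subseteq> agree F G"
      by (auto simp: agree_def)
    ultimately show ?thesis
      using finite_subset by blast
  qed
  ultimately have infinite_agree: "infinite (agree u v)" if "u \<in> range x \<union> Fin" "v \<in> range y \<union> Fin" for u v
    using that co_inf[OF gx] co_inf[OF gy] agree_commute by (auto simp: Fin_def)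
  have menger: "\<not> Menger_space (prod_topology (subtopology cantor (range x \<union> A)) (subtopology cantor (range y \<union> A)))"
    if "A \<subseteq> Fin" for A
  proof (rule not_Menger_space_prod)
    show "infinite (agree u v)" if "u \<in> range x \<union> A" "v \<in> range y \<union> A" for u v
      using that \<open>A \<subseteq> Fin\<close> by (intro infinite_agree) auto
    show "\<exists>u\<in>range x \<union> A. \<exists>v\<in>range y \<union> A. agree u v = d" if "infinite d" for d
      using xy[of d] that by (auto simp: D_def)
  qed
  show ?thesis
    using U(1) U'(1) U_scale_range[OF U inf(1)] U_scale_range[OF U' inf(2)] x[of Fin] y[of Fin]
      menger[of Fin] x[of "{}"] y[of "{}"] menger[of "{}"]
    by (intro exI[of _ U] exI[of _ U'] exI[of _ "range x"] exI[of _ "range y"]) simp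
qed

end
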